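(* Let $M$ be a closed regular simple convex planar curve. Then $$L_M^2=4\pi A_M+8\pi\left|\widetilde{A}_{E_{1/2}(M)}\right|+\pi\left|\widetilde{A}_{\mathrm{CWMS}(M)}\right|,$$ where $L_M$ is the length of $M$, $A_M$ is the area bounded by $M$, $\widetilde{A}_{E_{1/2}(M)}$ is the oriented area of the Wigner caustic of $M$, and $\widetilde{A}_{\mathrm{CWMS}(M)}$ is the oriented area of the Constant Width Measure Set of $M$.
   Context: Curves are $C^\infty$. A regular closed curve is convex if its signed curvature has a constant sign (curvature nowhere zero, positive for the positive orientation). A closed regular simple convex planar curve is called an oval; orient $M$ positively. Taking an origin $\Theta$ inside $M$, let $p(\theta)$ be the Minkowski support function of $M$ ($2\pi$-periodic); $M$ is parameterized by $\gamma(\theta)=(p(\theta)\cos\theta-p'(\theta)\sin\theta,\ p(\theta)\sin\theta+p'(\theta)\cos\theta)$, with curvature $1/(p+p'')>0$. An ordered pair $a\ne b$ of points of $M$ is a parallel pair if the tangent lines to $M$ at $a$ and $b$ are parallel; the parallel pairs are $\gamma(\theta),\gamma(\theta+\pi)$. Wigner caustic: $E_{1/2}(M)=\{\frac12(a+b) : a,b \text{ a parallel pair of } M\}$, parameterized by $\gamma_{1/2}(\theta)=\frac12(\gamma(\theta)+\gamma(\theta+\pi))$; since $\gamma_{1/2}(\theta+\pi)=\gamma_{1/2}(\theta)$, it is regarded as the closed curve traversed once, $\theta\in[0,\pi]$. Constant Width Measure Set: $\mathrm{CWMS}(M)=\{a-b+\overline{w}_M\,\mathbf{n}(a) : a,b\text{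 a parallel pair of }M\}$, where $\overline{w}_M=L_M/\pi$ is the average width and $\mathbf{n}$ is the continuous unit normal field to $M$ compatible with the orientation, i.e. $\mathbf n(\gamma(\theta))=-(\cos\theta,\sin\theta)$. It is parameterized by $\gamma(\theta)-\gamma(\theta+\pi)+\overline w_M\mathbf n(\gamma(\theta))$, $\theta\in[0,2\pi]$. The oriented area of an oriented closed curve $C$ is $\widetilde A_C=\frac12\int_C -y\,dx+x\,dy$ (zero if $C$ degenerates to a point). *)

theory Defs
  imports "HOL-Analysis.Analysis"
begin

text \<open>
  The Euclidean plane is the type \<^typ>\<open>complex\<close>. A closed curve is a map \<open>c\<close> on the real line
  with period 1, so that its restriction to \<open>[0,1]\<close> is a closed path in the sense of the library;
  the curve \<open>M\<close> as a point set is \<open>path_image c\<close>.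
\<close>

definition velocity :: "(real \<Rightarrow> complex) \<Rightarrow> real \<Rightarrow> complex" where
  "velocity c t = vector_derivative c (at t)"

definition smooth_curve :: "(real \<Rightarrow> complex) \<Rightarrow> bool" where
  "smooth_curve c \<longleftrightarrow> (\<forall>n t. (velocity ^^ n) c differentiable (at t))"

definition closed_regular_simple :: "(real \<Rightarrow> complex) \<Rightarrow> bool" where
  "closed_regular_simple c \<longleftrightarrow>
     smooth_curve c \<and> (\<forall>t. c (t + 1) = c t) \<and> (\<forall>t. velocity c t \<noteq> 0) \<and> simple_path c"

text \<open>
  For \<open>c = x + \<i> y\<close> the numerator is \<open>x' y'' - y' x''\<close>.
\<close>

definition signed_curvature :: "(real \<Rightarrow> complex) \<Rightarrow> real \<Rightarrow> real" where
  "signed_curvature c t =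
     Im (cnj (velocity c t) * velocity (velocity c) t) / norm (velocity c t) ^ 3"

definition convex_curve :: "(real \<Rightarrow> complex) \<Rightarrow> bool" where
  "convex_curve c \<longleftrightarrow>
     (\<forall>t. signed_curvature c t > 0) \<or> (\<forall>t. signed_curvature c t < 0)"

definition oval :: "(real \<Rightarrow> complex) \<Rightarrow> bool" where
  "oval c \<longleftrightarrow> closed_regular_simple c \<and> convex_curve c"

text \<open>
  For an oval the positive orientation is the one for which the curvature is positive; it can
  always be achieved by replacing \<open>c t\<close> by \<open>c (- t)\<close>, which does not change the point set.
\<close>

definition positively_oriented :: "(real \<Rightarrow> complex) \<Rightarrow> bool" where
  "positively_oriented c \<longleftrightarrow> (\<forall>t. signed_curvature c t > 0)"

definition curve_length :: "(real \<Rightarrow> complex) \<Rightarrow> real" where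
  "curve_length c = integral {0..1} (\<lambda>t. norm (velocity c t))"

definition enclosed_area :: "(real \<Rightarrow> complex) \<Rightarrow> real" where
  "enclosed_area c = measure lebesgue (inside (path_image c))"

definition oriented_area :: "real \<Rightarrow> real \<Rightarrow> (real \<Rightarrow> complex) \<Rightarrow> real" where
  "oriented_area a b g =
     (1/2) * integral {a..b} (\<lambda>t. - Im (g t) * Re (velocity g t) + Re (g t) * Im (velocity g t))"

definition tangent_line :: "(real \<Rightarrow> complex) \<Rightarrow> real \<Rightarrow> complex set" where
  "tangent_line c t = range (\<lambda>s. c t + s *\<^sub>R velocity c t)"

definition parallel_pair :: "(real \<Rightarrow> complex) \<Rightarrow> complex \<Rightarrow> complex \<Rightarrow> bool" where
  "parallel_pair c a b \<longleftrightarrow>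
     a \<noteq> b \<and> (\<exists>s t. a = c s \<and> b = c t \<and> affine_parallel (tangent_line c s) (tangent_line c t))"

text \<open>
  The unit normal at the point \<open>a\<close> of the curve: the unit tangent turned by \<open>\<pi>/2\<close>
  counterclockwise (here \<open>sgn z = z / \<bar>z\<bar>\<close>), hence the inward normal of a positively oriented oval.
  The value is unique because a regular simple closed curve passes through each of its points in
  one direction only.
\<close>

definition unit_normal :: "(real \<Rightarrow> complex) \<Rightarrow> complex \<Rightarrow> complex" where
  "unit_normal c a = (THE n. \<exists>t. c t = a \<and> n = \<i> * sgn (velocity c t))"

definition average_width :: "(real \<Rightarrow> complex) \<Rightarrow> real" where
  "average_width c = curve_length c / pi"

definition wigner_caustic :: "(real \<Rightarrow> complex) \<Rightarrow> complex set" where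
  "wigner_caustic c = {(1/2) * (a + b) | a b. parallel_pair c a b}"

definition CWMS :: "(real \<Rightarrow> complex) \<Rightarrow> complex set" where
  "CWMS c = {a - b + complex_of_real (average_width c) * unit_normal c a | a b. parallel_pair c a b}"

text \<open>
  The support function with respect to the origin of coordinates. Formulated as a supremum it makes
  sense for every position of the origin, and a translation of the origin changes neither the curve
  described by \<open>gamma\<close> nor any of the quantities below, so the origin is not required to lie
  inside \<open>M\<close>.
\<close>

definition support_function :: "(real \<Rightarrow> complex) \<Rightarrow> real \<Rightarrow> real" where
  "support_function c \<theta> = (SUP x\<in>path_image c. x \<bullet> cis \<theta>)"

definition gamma :: "(real \<Rightarrow> complex) \<Rightarrow> real \<Rightarrow> complex" where
  "gamma c \<theta> =
     (let p = support_function c; p' = deriv p in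
        Complex (p \<theta> * cos \<theta> - p' \<theta> * sin \<theta>) (p \<theta> * sin \<theta> + p' \<theta> * cos \<theta>))"

definition wigner_caustic_curve :: "(real \<Rightarrow> complex) \<Rightarrow> real \<Rightarrow> complex" where
  "wigner_caustic_curve c \<theta> = (1/2) * (gamma c \<theta> + gamma c (\<theta> + pi))"

definition CWMS_curve :: "(real \<Rightarrow> complex) \<Rightarrow> real \<Rightarrow> complex" where
  "CWMS_curve c \<theta> =
     gamma c \<theta> - gamma c (\<theta> + pi)
       + complex_of_real (average_width c) * unit_normal c (gamma c \<theta>)"

text \<open>
  The Wigner caustic is traversed once as \<open>\<theta>\<close> runs through \<open>[0,\<pi>]\<close>, since
  \<open>wigner_caustic_curve c\<close> has period \<open>\<pi>\<close>.
\<close>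

definition wigner_caustic_area :: "(real \<Rightarrow> complex) \<Rightarrow> real" where
  "wigner_caustic_area c = oriented_area 0 pi (wigner_caustic_curve c)"

definition CWMS_area :: "(real \<Rightarrow> complex) \<Rightarrow> real" where
  "CWMS_area c = oriented_area 0 (2 * pi) (CWMS_curve c)"

end

theory Submission
  imports Defs
begin

text \<open>
  Parametrize \<open>M\<close> by the angle \<open>\<theta>\<close> of its outward normal and let \<open>p\<close> be the support function.
  With \<open>s = p'\<close> and \<open>\<rho> = p + p''\<close> (the radius of curvature) the point with outward normal
  \<open>cis \<theta>\<close> is \<open>cis \<theta> * (p + \<i> s)\<close>, and it moves with velocity \<open>\<rho> \<i> cis \<theta>\<close>. Every curve
  \<open>cis \<theta> * (P + \<i> P')\<close>, regular or not, therefore has oriented area \<open>1/2 \<integral> P (P + P'')\<close>, and the two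
  derived curves are of this kind: the Wigner caustic has \<open>P = (p - p\<^sub>\<pi>) / 2\<close>, where
  \<open>p\<^sub>\<pi> \<theta> = p (\<theta> + \<pi>)\<close>, and the Constant Width Measure Set has \<open>P = p + p\<^sub>\<pi> - L/\<pi>\<close>. All integrals
  reduce to \<open>L = \<integral> p = \<integral> \<rho>\<close>, \<open>a = \<integral> p \<rho>\<close> and \<open>b = \<integral> p \<rho>\<^sub>\<pi>\<close> over one period: the enclosed
  area is \<open>a/2\<close>, the other two oriented areas are \<open>(a - b)/8\<close> and \<open>a + b - L\<^sup>2/\<pi>\<close>. Both functions
  \<open>P\<close> have mean zero, so the Wirtinger inequality \<open>\<integral> P\<^sup>2 \<le> \<integral> P'\<^sup>2\<close> makes
  \<open>\<integral> P (P + P'') = \<integral> P\<^sup>2 - P'\<^sup>2\<close> nonpositive. This fixes the signs of the absolute values, after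
  which the identity is linear in \<open>a\<close>, \<open>b\<close> and \<open>L\<^sup>2\<close> (\<open>support_isoperimetric_identity\<close>).

  Two geometric facts connect this calculation with the curve. The tangent of a simple closed
  curve turns exactly once (\<open>hopf_total_turning\<close>); with positive curvature each normal direction
  then occurs at exactly one point, which gives the parameter \<open>\<theta>\<close>, identifies the support function
  and shows that the parallel pairs are the pairs of points with opposite normals. Secondly, the
  inside of the curve is the interior of the convex body \<open>{z. \<forall>\<alpha>. z \<bullet> cis \<alpha> \<le> p \<alpha>}\<close>, whose area is
  computed by vertical slices (\<open>frontier_support_body\<close>, \<open>measure_support_body\<close>).
\<close>

section \<open>Periodic functions\<close>

lemma periodic_int:
  fixes f :: "real \<Rightarrow> 'a"
  assumes per: "\<And>t. f (t + T) = f t"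
  shows "f (t + of_int n * T) = f t"
proof (induction n arbitrary: t rule: int_induct[where k = 0])
  case (step1 i)
  then show ?case using per[of "t + of_int i * T"] by (simp add: algebra_simps)
next
  case (step2 i)
  then show ?case using per[of "t + of_int (i - 1) * T"] by (simp add: algebra_simps)
qed simp

lemma range_periodic:
  fixes f :: "real \<Rightarrow> 'a"
  assumes per: "\<And>t. f (t + T) = f t" and "0 < T"
  shows "f ` {a..a + T} = range f"
proof (intro equalityI subsetI)
  fix y assume "y \<in> range f"
  then obtain t where t: "y = f t" by auto
  let ?x = "(t - a) / T"
  have "a + T * frac ?x + of_int \<lfloor>?x\<rfloor> * T = t"
    using \<open>0 < T\<close> by (simp add: frac_def field_simps)
  then have "y = f (a + T * frac ?x)"
    using periodic_int[of f, OF per] t by metis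
  moreover have "a + T * frac ?x \<in> {a..a + T}"
    using \<open>0 < T\<close> frac_lt_1[of ?x] by (simp add: less_imp_le)
  ultimately show "y \<in> f ` {a..a + T}" by blast
qed auto

lemma periodic_vector_derivative:
  fixes f :: "real \<Rightarrow> 'a :: real_normed_vector"
  assumes f: "\<And>t. (f has_vector_derivative f' t) (at t)" and per: "\<And>t. f (t + T) = f t"
  shows "f' (t + T) = f' t"
proof (rule vector_derivative_unique_at)
  have "((f \<circ> (\<lambda>t. t + T)) has_vector_derivative 1 *\<^sub>R f' (t + T)) (at t)"
    by (rule vector_diff_chain_at)
       (auto intro!: derivative_eq_intros f simp: has_real_derivative_iff_has_vector_derivative[symmetric])
  moreover have "f \<circ> (\<lambda>t. t + T) = f"
    using per by auto
  ultimately show "(f has_vector_derivative f' (t + T)) (at t)" by simp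
qed (rule f)

lemma periodic_derivative:
  fixes f :: "real \<Rightarrow> real"
  assumes f: "\<And>t. (f has_real_derivative f' t) (at t)" and per: "\<And>t. f (t + T) = f t"
  shows "f' (t + T) = f' t"
  using periodic_vector_derivative[of f f', OF _ per] f
  by (simp add: has_real_derivative_iff_has_vector_derivative)

lemma antiderivative_on_line:
  fixes f :: "real \<Rightarrow> 'a :: euclidean_space"
  assumes "continuous_on UNIV f"
  obtains F where "\<And>t. (F has_vector_derivative f t) (at t)"
proof -
  have "\<exists>F. \<forall>t. - \<infinity> < ereal t \<longrightarrow> ereal t < \<infinity> \<longrightarrow> (F has_vector_derivative f t) (at t)"
    by (rule einterval_antiderivative) (use assms in \<open>auto simp: continuous_on_eq_continuous_at\<close>)
  then show thesis using that by auto
qed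

text \<open>
  The increment over one period has derivative zero in its starting point. This serves for
  integrals over a period as well as for the turning of the tangent angle.
\<close>

lemma constant_increment_of_periodic_derivative:
  fixes F f :: "real \<Rightarrow> real"
  assumes F: "\<And>t. (F has_real_derivative f t) (at t)" and per: "\<And>t. f (t + T) = f t"
  shows "F (a + T) - F a = F (b + T) - F b"
proof -
  have "((\<lambda>t. F (t + T) - F t) has_real_derivative 0) (at t)" for t
    using DERIV_diff[OF iffD1[OF DERIV_shift F[of "t + T"]] F[of t]] by (simp add: per)
  then show ?thesis
    using DERIV_isconst_all[of "\<lambda>t. F (t + T) - F t"] by blast
qed

lemma integral_over_period:
  fixes f :: "real \<Rightarrow> real"
  assumes f: "continuous_on UNIV f" and per: "\<And>t. f (t + T) = f t" and "0 \<le> T"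
  shows "integral {a..a + T} f = integral {b..b + T} f"
proof -
  obtain F where "\<And>t. (F has_vector_derivative f t) (at t)"
    using antiderivative_on_line[OF f] by blast
  then have F: "\<And>t. (F has_real_derivative f t) (at t)"
    by (simp add: has_real_derivative_iff_has_vector_derivative)
  have "(f has_integral F (a + T) - F a) {a..a + T}" for a
    using F \<open>0 \<le> T\<close>
    by (intro fundamental_theorem_of_calculus)
       (auto simp: has_real_derivative_iff_has_vector_derivative intro: has_vector_derivative_at_within)
  then show ?thesis
    using constant_increment_of_periodic_derivative[OF F per, of a b] by (metis integral_unique)
qed

lemma integral_shifted_over_period:
  fixes f :: "real \<Rightarrow> real"
  assumes f: "continuous_on UNIV f" and per: "\<And>t. f (t + T) = f t" and "0 \<le> T"
  shows "integral {a..a + T} (\<lambda>t. f (t + d)) = integral {a..a + T} f"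
proof -
  have "integral {a..a + T} (f \<circ> (\<lambda>t. t + d)) = integral {a + d..a + T + d} f"
    by (rule integral_shift) (rule continuous_on_subset[OF f subset_UNIV])
  then show ?thesis
    using integral_over_period[OF assms, of "a + d" a] by (simp add: o_def ac_simps)
qed

lemma continuous_onI_has_real_derivative:
  fixes f :: "real \<Rightarrow> real"
  assumes "\<And>t. (f has_real_derivative f' t) (at t)"
  shows "continuous_on S f"
  by (intro continuous_at_imp_continuous_on ballI DERIV_isCont[OF assms])

lemma integral_derivative_over_period:
  fixes f :: "real \<Rightarrow> real"
  assumes f: "\<And>t. (f has_real_derivative f' t) (at t)" and "f (a + T) = f a" "0 \<le> T"
  shows "integral {a..a + T} f' = 0"
proof -
  have "(f' has_integral f (a + T) - f a) {a..a + T}"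
    using f \<open>0 \<le> T\<close>
    by (intro fundamental_theorem_of_calculus)
       (auto simp: has_real_derivative_iff_has_vector_derivative intro: has_vector_derivative_at_within)
  then show ?thesis using assms(2) by (simp add: integral_unique)
qed

section \<open>The Wirtinger inequality\<close>

text \<open>
  Both difference quotients converge, and their quotient is \<open>f x / g x\<close>.
\<close>

lemma tendsto_quotient_at_common_zero:
  fixes f g :: "real \<Rightarrow> real"
  assumes f: "(f has_real_derivative D) (at z)" and g: "(g has_real_derivative E) (at z)"
    and "E \<noteq> 0" "f z = 0" "g z = 0"
  shows "(\<lambda>x. f x / g x) \<midarrow>z\<rightarrow> D / E"
proof -
  have "(\<lambda>x. (f x - f z) / (x - z)) \<midarrow>z\<rightarrow> D" "(\<lambda>x. (g x - g z) / (x - z)) \<midarrow>z\<rightarrow> E"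
    using f g by (simp_all add: has_field_derivative_iff)
  from tendsto_divide[OF this \<open>E \<noteq> 0\<close>] show ?thesis
    by (rule Lim_transform_eventually)
       (auto simp: eventually_at_filter assms(4,5) intro!: always_eventually)
qed

text \<open>
  The pole of the cotangent is cancelled by one of the two factors \<open>f\<close>; the other one makes the
  product tend to zero, its value at \<open>z\<close>.
\<close>

lemma isCont_square_times_cot:
  fixes f :: "real \<Rightarrow> real"
  assumes f: "(f has_real_derivative D) (at z)" and "f z = 0" and sin: "sin (z - a) = 0"
  shows "isCont (\<lambda>x. (f x)\<^sup>2 * cot (x - a)) z"
proof -
  have "cos (z - a) \<noteq> 0"
    using sin sin_cos_squared_add[of "z - a"] by auto
  moreover have "((\<lambda>x. sin (x - a)) has_real_derivative cos (z - a)) (at z)"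
    by (auto intro!: derivative_eq_intros)
  ultimately have "(\<lambda>x. f x / sin (x - a)) \<midarrow>z\<rightarrow> D / cos (z - a)"
    using assms by (intro tendsto_quotient_at_common_zero)
  moreover have "f \<midarrow>z\<rightarrow> 0" "(\<lambda>x. cos (x - a)) \<midarrow>z\<rightarrow> cos (z - a)"
    using DERIV_isCont[OF f] \<open>f z = 0\<close> by (auto simp: isCont_def intro!: tendsto_intros)
  ultimately have "(\<lambda>x. f x * (f x / sin (x - a)) * cos (x - a)) \<midarrow>z\<rightarrow> 0 * (D / cos (z - a)) * cos (z - a)"
    by (intro tendsto_mult)
  then show ?thesis
    by (simp add: isCont_def cot_def \<open>f z = 0\<close> power2_eq_square)
qed

text \<open>
  Completing the square with the cotangent gives
  \<open>f'\<^sup>2 - f\<^sup>2 = (f' - f cot)\<^sup>2 + (f\<^sup>2 cot)'\<close>, the cotangent being centred at \<open>a\<close>. The function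
  \<open>f\<^sup>2 cot\<close> vanishes at both ends of the interval, so the last term integrates to zero.
\<close>

lemma wirtinger_between_zeros:
  fixes f f' :: "real \<Rightarrow> real"
  assumes f: "\<And>x. (f has_real_derivative f' x) (at x)" and f': "continuous_on UNIV f'"
    and zeros: "f a = 0" "f (a + pi) = 0"
  shows "integral {a..a + pi} (\<lambda>x. (f x)\<^sup>2) \<le> integral {a..a + pi} (\<lambda>x. (f' x)\<^sup>2)"
proof -
  define F where "F = (\<lambda>x. (f x)\<^sup>2 * cot (x - a))"
  define F' where "F' = (\<lambda>x. 2 * f x * f' x * cot (x - a) - (f x)\<^sup>2 / (sin (x - a))\<^sup>2)"
  have inner: "(F has_real_derivative F' x) (at x)" "sin (x - a) > 0" if "x \<in> {a<..<a + pi}" for x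
  proof -
    show "sin (x - a) > 0" using that by (intro sin_gt_zero) auto
    then have "((\<lambda>x. cot (x - a)) has_real_derivative - inverse ((sin (x - a))\<^sup>2) * 1) (at x)"
      by (intro DERIV_chain2[OF DERIV_cot]) (auto intro!: derivative_eq_intros)
    then show "(F has_real_derivative F' x) (at x)"
      unfolding F_def F'_def by (auto intro!: derivative_eq_intros f simp: divide_inverse)
  qed
  have "continuous_on {a..a + pi} F"
  proof (rule continuous_at_imp_continuous_on, rule ballI)
    fix x assume "x \<in> {a..a + pi}"
    then consider "x = a" | "x = a + pi" | "x \<in> {a<..<a + pi}" by force
    then show "isCont F x"
    proof cases
      case 3
      then show ?thesis using inner(1) DERIV_isCont by blast
    qed (use zeros in \<open>auto simp: F_def intro!: isCont_square_times_cot f\<close>)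
  qed
  then have "(F' has_integral F (a + pi) - F a) {a..a + pi}"
    using inner(1)
    by (intro fundamental_theorem_of_calculus_interior)
       (auto simp: has_real_derivative_iff_has_vector_derivative)
  then have F'_int: "(F' has_integral 0) {a..a + pi}"
    by (simp add: F_def zeros)
  have contf: "continuous_on {a..a + pi} f"
    by (rule continuous_onI_has_real_derivative[OF f])
  have contf': "continuous_on {a..a + pi} f'"
    by (rule continuous_on_subset[OF f' subset_UNIV])
  have int: "(\<lambda>x. (f x)\<^sup>2) integrable_on {a..a + pi}" "(\<lambda>x. (f' x)\<^sup>2) integrable_on {a..a + pi}"
    by (auto intro!: integrable_continuous_interval continuous_intros contf contf')
  have "((\<lambda>x. (f' x)\<^sup>2 - (f x)\<^sup>2 - F' x) has_integral
          integral {a..a + pi} (\<lambda>x. (f' x)\<^sup>2) - integral {a..a + pi} (\<lambda>x. (f x)\<^sup>2) - 0) {a..a + pi}"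
    by (intro has_integral_diff integrable_integral int F'_int)
  moreover have "0 \<le> (f' x)\<^sup>2 - (f x)\<^sup>2 - F' x" if "x \<in> {a..a + pi}" for x
  proof (cases "x \<in> {a<..<a + pi}")
    case True
    define C where "C = cot (x - a)"
    have "1 / (sin (x - a))\<^sup>2 = 1 + C\<^sup>2"
      using inner(2)[OF True] sin_cos_squared_add[of "x - a"]
      by (simp add: C_def cot_def field_simps)
    then have "(f x)\<^sup>2 / (sin (x - a))\<^sup>2 = (f x)\<^sup>2 * (1 + C\<^sup>2)"
      by (metis times_divide_eq_right mult.right_neutral)
    then have "(f' x)\<^sup>2 - (f x)\<^sup>2 - F' x = (f' x - f x * C)\<^sup>2"
      by (simp add: F'_def C_def[symmetric] power2_eq_square algebra_simps)
    then show ?thesis by simp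
  next
    case False
    then have "f x = 0" using that zeros by force
    then show ?thesis by (simp add: F'_def)
  qed
  ultimately have "0 \<le> integral {a..a + pi} (\<lambda>x. (f' x)\<^sup>2) - integral {a..a + pi} (\<lambda>x. (f x)\<^sup>2) - 0"
    by (rule has_integral_nonneg)
  then show ?thesis by simp
qed

text \<open>
  By the intermediate value theorem \<open>f (a + pi) = f a\<close> for some \<open>a\<close>. Subtracting this value \<open>f a\<close>
  produces zeros at \<open>a\<close>, \<open>a + pi\<close> and \<open>a + 2 pi\<close>, so the previous lemma applies to both half
  periods. As the mean is zero, the subtraction can only increase the integral of the square.
\<close>

lemma wirtinger_inequality:
  fixes f f' :: "real \<Rightarrow> real"
  assumes f: "\<And>x. (f has_real_derivative f' x) (at x)" and f': "continuous_on UNIV f'"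
    and per: "\<And>x. f (x + 2 * pi) = f x"
    and mean: "integral {0..2 * pi} f = 0"
  shows "integral {0..2 * pi} (\<lambda>x. (f x)\<^sup>2) \<le> integral {0..2 * pi} (\<lambda>x. (f' x)\<^sup>2)"
proof -
  have contf: "continuous_on S f" for S
    by (rule continuous_onI_has_real_derivative[OF f])
  have per': "f' (x + 2 * pi) = f' x" for x
    by (rule periodic_derivative[OF f per])
  have twice: "x + pi + pi = x + 2 * pi" for x :: real by simp
  obtain a where a: "f (a + pi) = f a"
  proof -
    \<comment> \<open>A zero of \<open>d\<close> is wanted; periodicity makes \<open>d pi\<close> the negative of \<open>d 0\<close>.\<close>
    define d where "d = (\<lambda>x. f (x + pi) - f x)"
    have cont: "continuous_on {0..pi} d"
      unfolding d_def
      by (intro continuous_on_diff contf, rule continuous_on_compose2[OF contf[of UNIV]])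
         (intro continuous_intros subset_UNIV)+
    have "d pi = - d 0"
      using per[of 0] twice[of 0] by (simp add: d_def)
    then have "\<exists>x. 0 \<le> x \<and> x \<le> pi \<and> d x = 0"
      using IVT'[of d 0 0 pi] IVT2'[of d pi 0 0] cont by (cases "d 0 \<le> 0") auto
    then show thesis using that by (auto simp: d_def)
  qed
  define g where "g = (\<lambda>x. f x - f a)"
  have g: "(g has_real_derivative f' x) (at x)" for x
    unfolding g_def by (auto intro!: derivative_eq_intros f)
  have contg: "continuous_on S g" for S
    by (rule continuous_onI_has_real_derivative[OF g])
  have "f (a + pi + pi) = f a" unfolding twice by (rule per)
  then have gz: "g a = 0" "g (a + pi) = 0" "g (a + pi + pi) = 0"
    using a by (simp_all add: g_def)
  have split: "integral {a..a + 2 * pi} h = integral {a..a + pi} h + integral {a + pi..a + pi + pi} h"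
    if "continuous_on UNIV h" for h :: "real \<Rightarrow> real"
    unfolding twice
    by (rule Henstock_Kurzweil_Integration.integral_combine[symmetric])
       (auto intro: integrable_continuous_interval continuous_on_subset[OF that])
  have sq: "continuous_on UNIV (\<lambda>x. (g x)\<^sup>2)" "continuous_on UNIV (\<lambda>x. (f x)\<^sup>2)" "continuous_on UNIV (\<lambda>x. (f' x)\<^sup>2)"
    by (intro continuous_intros contg contf f')+
  have "integral {a..a + 2 * pi} (\<lambda>x. (g x)\<^sup>2) \<le> integral {a..a + 2 * pi} (\<lambda>x. (f' x)\<^sup>2)"
    unfolding split[OF sq(1)] split[OF sq(3)]
    by (intro add_mono wirtinger_between_zeros g f' gz)
  moreover have "integral {a..a + 2 * pi} h = integral {0..2 * pi} h"
    if "continuous_on UNIV h" "\<And>x. h (x + 2 * pi) = h x" for h :: "real \<Rightarrow> real"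
    using integral_over_period[OF that, of a 0] by simp
  moreover have "integral {0..2 * pi} (\<lambda>x. (g x)\<^sup>2) = integral {0..2 * pi} (\<lambda>x. (f x)\<^sup>2) + 2 * pi * (f a)\<^sup>2"
  proof -
    have const: "((\<lambda>x. (f a)\<^sup>2) has_integral 2 * pi * (f a)\<^sup>2) {0..2 * pi}"
      using has_integral_const_real[of "(f a)\<^sup>2" 0 "2 * pi"] by simp
    have "((\<lambda>x. (f x)\<^sup>2 - 2 * f a * f x + (f a)\<^sup>2) has_integral
        integral {0..2 * pi} (\<lambda>x. (f x)\<^sup>2) - 2 * f a * integral {0..2 * pi} f + 2 * pi * (f a)\<^sup>2) {0..2 * pi}"
      by (intro has_integral_add has_integral_diff has_integral_mult_right const integrable_integral
          integrable_continuous_interval continuous_intros contf)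
    then have "integral {0..2 * pi} (\<lambda>x. (f x)\<^sup>2 - 2 * f a * f x + (f a)\<^sup>2) =
        integral {0..2 * pi} (\<lambda>x. (f x)\<^sup>2) + 2 * pi * (f a)\<^sup>2"
      by (simp add: integral_unique mean)
    moreover have "(\<lambda>x. (g x)\<^sup>2) = (\<lambda>x. (f x)\<^sup>2 - 2 * f a * f x + (f a)\<^sup>2)"
      by (simp add: g_def power2_diff algebra_simps fun_eq_iff)
    ultimately show ?thesis by simp
  qed
  moreover have "g (x + 2 * pi) = g x" for x
    by (simp add: g_def per)
  ultimately have "integral {0..2 * pi} (\<lambda>x. (f x)\<^sup>2) + 2 * pi * (f a)\<^sup>2
      \<le> integral {0..2 * pi} (\<lambda>x. (f' x)\<^sup>2)"
    using sq(1,3) per' by simp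
  moreover have "0 \<le> 2 * pi * (f a)\<^sup>2" by simp
  ultimately show ?thesis by linarith
qed

section \<open>Curves given by a support function\<close>

text \<open>
  For \<open>S = P'\<close> this is the envelope of the lines \<open>{z. z \<bullet> cis \<theta> = P \<theta>}\<close>, with \<open>P\<close> and \<open>S\<close> the
  coordinates of the point of contact in the frame \<open>cis \<theta>, \<i> cis \<theta>\<close>. The derivative is a separate
  argument, so that no differentiability has to be recovered from the curve.
\<close>

definition support_curve :: "(real \<Rightarrow> real) \<Rightarrow> (real \<Rightarrow> real) \<Rightarrow> real \<Rightarrow> complex" where
  "support_curve P S \<theta> = cis \<theta> * Complex (P \<theta>) (S \<theta>)"

lemma support_curve_has_vector_derivative:
  assumes "(P has_real_derivative S \<theta>) (at \<theta>)" "(S has_real_derivative R - P \<theta>) (at \<theta>)"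
  shows "(support_curve P S has_vector_derivative \<i> * cis \<theta> * of_real R) (at \<theta>)"
proof -
  have "((\<lambda>\<theta>. of_real (cos \<theta> * P \<theta> - sin \<theta> * S \<theta>) + \<i> * of_real (sin \<theta> * P \<theta> + cos \<theta> * S \<theta>))
       has_vector_derivative of_real (- sin \<theta> * R) + \<i> * of_real (cos \<theta> * R)) (at \<theta>)"
    by (intro has_vector_derivative_add has_vector_derivative_mult_right has_vector_derivative_of_real)
       (auto intro!: derivative_eq_intros assms simp: algebra_simps)
  moreover have "support_curve P S = (\<lambda>\<theta>. of_real (cos \<theta> * P \<theta> - sin \<theta> * S \<theta>) + \<i> * of_real (sin \<theta> * P \<theta> + cos \<theta> * S \<theta>))"
    by (rule ext) (simp add: support_curve_def complex_eq_iff)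
  moreover have "\<i> * cis \<theta> * of_real R = of_real (- sin \<theta> * R) + \<i> * of_real (cos \<theta> * R)"
    by (simp add: complex_eq_iff)
  ultimately show ?thesis by simp
qed

text \<open>
  The velocity is tangential, so in the moving frame only the normal component \<open>P\<close> of the position
  contributes to the area element.
\<close>

lemma oriented_area_support_curve:
  assumes "\<And>\<theta>. (P has_real_derivative S \<theta>) (at \<theta>)" "\<And>\<theta>. (S has_real_derivative R \<theta> - P \<theta>) (at \<theta>)"
  shows "oriented_area a b (support_curve P S) = 1/2 * integral {a..b} (\<lambda>\<theta>. P \<theta> * R \<theta>)"
proof -
  have "velocity (support_curve P S) \<theta> = \<i> * cis \<theta> * of_real (R \<theta>)" for \<theta>
    unfolding velocity_def using support_curve_has_vector_derivative[OF assms] vector_derivative_at by blast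
  moreover have "- Im (support_curve P S \<theta>) * Re (\<i> * cis \<theta> * of_real (R \<theta>))
      + Re (support_curve P S \<theta>) * Im (\<i> * cis \<theta> * of_real (R \<theta>)) = P \<theta> * R \<theta>" for \<theta>
  proof -
    have "- Im (support_curve P S \<theta>) * Re (\<i> * cis \<theta> * of_real (R \<theta>))
        + Re (support_curve P S \<theta>) * Im (\<i> * cis \<theta> * of_real (R \<theta>))
        = P \<theta> * R \<theta> * (cos \<theta> * cos \<theta> + sin \<theta> * sin \<theta>)"
      unfolding distrib_left by (simp add: support_curve_def algebra_simps)
    then show ?thesis by (simp only: sin_cos_squared_add3)
  qed
  ultimately show ?thesis
    by (simp add: oriented_area_def)
qed

text \<open>
  Here \<open>R\<close> is \<open>P + P''\<close>; integrating by parts over the period turns the integral into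
  \<open>\<integral> P\<^sup>2 - P'\<^sup>2\<close>, and the Wirtinger inequality applies.
\<close>

lemma support_area_nonpos:
  assumes P: "\<And>\<theta>. (P has_real_derivative S \<theta>) (at \<theta>)" and S: "\<And>\<theta>. (S has_real_derivative R \<theta> - P \<theta>) (at \<theta>)"
    and R: "continuous_on UNIV R"
    and per: "\<And>\<theta>. P (\<theta> + 2 * pi) = P \<theta>" and mean: "integral {0..2 * pi} P = 0"
  shows "integral {0..2 * pi} (\<lambda>\<theta>. P \<theta> * R \<theta>) \<le> 0"
proof -
  have cP: "continuous_on A P" and cS: "continuous_on A S" for A
    by (rule continuous_onI_has_real_derivative P S)+
  have perS: "S (0 + 2 * pi) = S 0"
    by (rule periodic_derivative[OF P per])
  have cR: "continuous_on {0..2*pi} R" by (rule continuous_on_subset[OF R subset_UNIV])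
  have "integral {0..0 + 2 * pi} (\<lambda>\<theta>. (S \<theta>)\<^sup>2 + P \<theta> * (R \<theta> - P \<theta>)) = 0"
    by (rule integral_derivative_over_period[where f = "\<lambda>\<theta>. P \<theta> * S \<theta>"])
       (use per[of 0] perS in \<open>auto intro!: derivative_eq_intros P S simp: power2_eq_square algebra_simps\<close>)
  also have "(\<lambda>\<theta>. (S \<theta>)\<^sup>2 + P \<theta> * (R \<theta> - P \<theta>)) = (\<lambda>\<theta>. (S \<theta>)\<^sup>2 + P \<theta> * R \<theta> - (P \<theta>)\<^sup>2)"
    by (simp add: power2_eq_square algebra_simps)
  finally have "integral {0..2 * pi} (\<lambda>\<theta>. (S \<theta>)\<^sup>2 + P \<theta> * R \<theta> - (P \<theta>)\<^sup>2) = 0" by simp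
  also have "integral {0..2 * pi} (\<lambda>\<theta>. (S \<theta>)\<^sup>2 + P \<theta> * R \<theta> - (P \<theta>)\<^sup>2) = integral {0..2 * pi} (\<lambda>\<theta>. (S \<theta>)\<^sup>2)
       + integral {0..2 * pi} (\<lambda>\<theta>. P \<theta> * R \<theta>) - integral {0..2 * pi} (\<lambda>\<theta>. (P \<theta>)\<^sup>2)"
    by (intro integral_unique has_integral_add has_integral_diff integrable_integral
        integrable_continuous_interval continuous_intros cP cS cR)
  finally show ?thesis
    using wirtinger_inequality[OF P cS per mean] by simp
qed

text \<open>
  The theorem in terms of the support function: the three terms on the right are the enclosed area
  and the oriented areas of the Wigner caustic and of the Constant Width Measure Set.
\<close>

lemma support_isoperimetric_identity:
  fixes p s \<rho> :: "real \<Rightarrow> real"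
  assumes p: "\<And>\<theta>. (p has_real_derivative s \<theta>) (at \<theta>)"
    and s: "\<And>\<theta>. (s has_real_derivative \<rho> \<theta> - p \<theta>) (at \<theta>)"
    and \<rho>: "continuous_on UNIV \<rho>"
    and per: "\<And>\<theta>. p (\<theta> + 2 * pi) = p \<theta>"
    and L: "L = integral {0..2 * pi} \<rho>"
  shows "L\<^sup>2 = 4 * pi * (1/2 * integral {0..2 * pi} (\<lambda>\<theta>. p \<theta> * \<rho> \<theta>))
      + 8 * pi * \<bar>1/2 * integral {0..pi} (\<lambda>\<theta>. (p \<theta> - p (\<theta> + pi)) / 2 * ((\<rho> \<theta> - \<rho> (\<theta> + pi)) / 2))\<bar>
      + pi * \<bar>1/2 * integral {0..2 * pi} (\<lambda>\<theta>. (p \<theta> + p (\<theta> + pi) - L / pi) * (\<rho> \<theta> + \<rho> (\<theta> + pi) - L / pi))\<bar>"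
proof -
  have per_s: "s (\<theta> + 2 * pi) = s \<theta>" for \<theta>
    by (rule periodic_derivative[OF p per])
  have per_\<rho>: "\<rho> (\<theta> + 2 * pi) = \<rho> \<theta>" for \<theta>
    using periodic_derivative[OF s per_s, of \<theta>] per[of \<theta>] by simp
  have twice: "\<theta> + pi + pi = \<theta> + 2 * pi" for \<theta> :: real by simp
  have p\<pi>: "((\<lambda>\<theta>. p (\<theta> + pi)) has_real_derivative s (\<theta> + pi)) (at \<theta>)"
    and s\<pi>: "((\<lambda>\<theta>. s (\<theta> + pi)) has_real_derivative \<rho> (\<theta> + pi) - p (\<theta> + pi)) (at \<theta>)" for \<theta>
    using p[of "\<theta> + pi"] s[of "\<theta> + pi"] unfolding DERIV_shift .
  have cp: "continuous_on A p" and cp\<pi>: "continuous_on A (\<lambda>\<theta>. p (\<theta> + pi))" for A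
    by (rule continuous_onI_has_real_derivative p p\<pi>)+
  have c\<rho>: "continuous_on A \<rho>" for A
    by (rule continuous_on_subset[OF \<rho> subset_UNIV])
  have c\<rho>\<pi>: "continuous_on A (\<lambda>\<theta>. \<rho> (\<theta> + pi))" for A
    by (rule continuous_on_compose2[OF \<rho>]) (intro continuous_intros subset_UNIV)+
  note cont = continuous_intros cp cp\<pi> c\<rho> c\<rho>\<pi>
  let ?I = "integral {0..2 * pi}"
  have shift: "?I (\<lambda>\<theta>. f (\<theta> + pi)) = ?I f"
    if "continuous_on UNIV f" "\<And>\<theta>. f (\<theta> + 2 * pi) = f \<theta>" for f :: "real \<Rightarrow> real"
    using integral_shifted_over_period[OF that, of 0 pi] by simp
  define A where "A = ?I (\<lambda>\<theta>. p \<theta> * \<rho> \<theta>)"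
  define B where "B = ?I (\<lambda>\<theta>. p \<theta> * \<rho> (\<theta> + pi))"
  have A\<pi>: "?I (\<lambda>\<theta>. p (\<theta> + pi) * \<rho> (\<theta> + pi)) = A"
    unfolding A_def by (rule shift) (use per per_\<rho> in \<open>auto intro!: cont\<close>)
  have B\<pi>: "?I (\<lambda>\<theta>. p (\<theta> + pi) * \<rho> \<theta>) = B"
    using shift[of "\<lambda>\<theta>. p \<theta> * \<rho> (\<theta> + pi)"] per per_\<rho> per_\<rho>[of "\<theta> + pi" for \<theta>]
    by (simp add: B_def twice cont ac_simps)
  have Ip: "?I p = L"
  proof -
    have "?I (\<lambda>\<theta>. \<rho> \<theta> - p \<theta>) = 0"
      using integral_derivative_over_period[of s "\<lambda>\<theta>. \<rho> \<theta> - p \<theta>" 0 "2 * pi", OF s] per_s[of 0] by simp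
    moreover have "?I (\<lambda>\<theta>. \<rho> \<theta> - p \<theta>) = ?I \<rho> - ?I p"
      by (rule integral_diff) (auto intro!: integrable_continuous_interval cp c\<rho>)
    ultimately show ?thesis using L by simp
  qed
  have Ip\<pi>: "?I (\<lambda>\<theta>. p (\<theta> + pi)) = L" and I\<rho>\<pi>: "?I (\<lambda>\<theta>. \<rho> (\<theta> + pi)) = L"
    using shift[OF cp per] shift[OF c\<rho> per_\<rho>] Ip L by simp_all
  have has: "(f has_integral J) {0..2 * pi}" if "?I f = J" "continuous_on UNIV f" for f :: "real \<Rightarrow> real" and J
    using that integrable_continuous_interval[OF continuous_on_subset[OF that(2) subset_UNIV]]
    by (metis integrable_integral)
  have hA: "((\<lambda>\<theta>. p \<theta> * \<rho> \<theta>) has_integral A) {0..2 * pi}"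
    and hB: "((\<lambda>\<theta>. p \<theta> * \<rho> (\<theta> + pi)) has_integral B) {0..2 * pi}"
    and hA\<pi>: "((\<lambda>\<theta>. p (\<theta> + pi) * \<rho> (\<theta> + pi)) has_integral A) {0..2 * pi}"
    and hB\<pi>: "((\<lambda>\<theta>. p (\<theta> + pi) * \<rho> \<theta>) has_integral B) {0..2 * pi}"
    and hp: "(p has_integral L) {0..2 * pi}" and hp\<pi>: "((\<lambda>\<theta>. p (\<theta> + pi)) has_integral L) {0..2 * pi}"
    and h\<rho>: "(\<rho> has_integral L) {0..2 * pi}" and h\<rho>\<pi>: "((\<lambda>\<theta>. \<rho> (\<theta> + pi)) has_integral L) {0..2 * pi}"
    by (rule has; (intro cont)?; simp add: A_def B_def A\<pi> B\<pi> Ip Ip\<pi> L[symmetric] I\<rho>\<pi>)+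
  have hc: "((\<lambda>\<theta>. c) has_integral 2 * pi * c) {0..2 * pi}" for c :: real
    using has_integral_const_real[of c 0 "2 * pi"] by simp
  have pp: "p (\<theta> + 2 * pi + pi) = p (\<theta> + pi)" for \<theta>
    using per[of "\<theta> + pi"] by (simp add: ac_simps)
  note combine = has_integral_add has_integral_diff has_integral_mult_right
    hA hB hA\<pi> hB\<pi> hp hp\<pi> h\<rho> h\<rho>\<pi> hc

  \<comment> \<open>The integrand of the Wigner caustic has period \<open>pi\<close>, so its integral over
      \<open>[0, pi]\<close> is half of the integral over \<open>[0, 2 pi]\<close>, where the shift by \<open>pi\<close> acts.\<close>
  define W where "W = (\<lambda>\<theta>. (p \<theta> - p (\<theta> + pi)) / 2 * ((\<rho> \<theta> - \<rho> (\<theta> + pi)) / 2))"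
  have cW: "continuous_on S W" for S
    unfolding W_def by (intro cont) auto
  have W\<pi>: "W (\<theta> + pi) = W \<theta>" for \<theta>
    using per[of \<theta>] per_\<rho>[of \<theta>] by (simp add: W_def twice algebra_simps)
  have "integral {0..pi} W + integral {pi..2 * pi} W = ?I W"
    by (rule Henstock_Kurzweil_Integration.integral_combine)
       (auto intro!: integrable_continuous_interval cW)
  moreover have "integral {pi..2 * pi} W = integral {0..pi} W"
    using integral_over_period[OF cW W\<pi>, of pi 0] by simp
  ultimately have "2 * integral {0..pi} W = ?I W" by simp
  also have "?I W = (A - B) / 2"
  proof -
    have "((\<lambda>\<theta>. 1/4 * (p \<theta> * \<rho> \<theta> - p \<theta> * \<rho> (\<theta> + pi) - p (\<theta> + pi) * \<rho> \<theta> + p (\<theta> + pi) * \<rho> (\<theta> + pi)))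
        has_integral 1/4 * (A - B - B + A)) {0..2 * pi}"
      by (intro combine)
    moreover have "W = (\<lambda>\<theta>. 1/4 * (p \<theta> * \<rho> \<theta> - p \<theta> * \<rho> (\<theta> + pi) - p (\<theta> + pi) * \<rho> \<theta> + p (\<theta> + pi) * \<rho> (\<theta> + pi)))"
      by (simp add: W_def fun_eq_iff field_simps)
    ultimately have "?I W = 1/4 * (A - B - B + A)"
      by (simp only: integral_unique)
    then show ?thesis by simp
  qed
  finally have W: "integral {0..pi} W = (A - B) / 4" by simp
  have "?I W \<le> 0"
    unfolding W_def
  proof (rule support_area_nonpos[where S = "\<lambda>\<theta>. (s \<theta> - s (\<theta> + pi)) / 2"])
    show "(p (\<theta> + 2 * pi) - p (\<theta> + 2 * pi + pi)) / 2 = (p \<theta> - p (\<theta> + pi)) / 2" for \<theta>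
      unfolding per pp ..
    show "?I (\<lambda>\<theta>. (p \<theta> - p (\<theta> + pi)) / 2) = 0"
      using integral_unique[OF has_integral_diff[OF hp hp\<pi>]] by simp
  qed (auto intro!: derivative_eq_intros p s p\<pi> s\<pi> cont simp: per pp field_simps)
  then have W_sign: "A - B \<le> 0"
    using \<open>?I W = (A - B) / 2\<close> by simp

  define C where "C = (\<lambda>\<theta>. (p \<theta> + p (\<theta> + pi) - L / pi) * (\<rho> \<theta> + \<rho> (\<theta> + pi) - L / pi))"
  have C: "?I C = 2 * A + 2 * B - 2 * L\<^sup>2 / pi"
  proof -
    have "((\<lambda>\<theta>. p \<theta> * \<rho> \<theta> + p \<theta> * \<rho> (\<theta> + pi) + p (\<theta> + pi) * \<rho> \<theta> + p (\<theta> + pi) * \<rho> (\<theta> + pi)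
          - L / pi * (p \<theta> + p (\<theta> + pi)) - L / pi * (\<rho> \<theta> + \<rho> (\<theta> + pi)) + (L / pi)\<^sup>2)
        has_integral A + B + B + A - L / pi * (L + L) - L / pi * (L + L) + 2 * pi * (L / pi)\<^sup>2) {0..2 * pi}"
      by (intro combine)
    moreover have "C = (\<lambda>\<theta>. p \<theta> * \<rho> \<theta> + p \<theta> * \<rho> (\<theta> + pi) + p (\<theta> + pi) * \<rho> \<theta> + p (\<theta> + pi) * \<rho> (\<theta> + pi)
          - L / pi * (p \<theta> + p (\<theta> + pi)) - L / pi * (\<rho> \<theta> + \<rho> (\<theta> + pi)) + (L / pi)\<^sup>2)"
      by (rule ext) (simp add: C_def power2_eq_square algebra_simps)
    ultimately have "?I C = A + B + B + A - L / pi * (L + L) - L / pi * (L + L) + 2 * pi * (L / pi)\<^sup>2"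
      by (simp only: integral_unique)
    moreover have "2 * pi * (L / pi)\<^sup>2 = 2 * (L\<^sup>2 / pi)" "L / pi * (L + L) = 2 * (L\<^sup>2 / pi)"
      by (simp_all add: power2_eq_square)
    ultimately show ?thesis by simp
  qed
  have C_sign: "?I C \<le> 0"
    unfolding C_def
  proof (rule support_area_nonpos[where S = "\<lambda>\<theta>. s \<theta> + s (\<theta> + pi)"])
    show "p (\<theta> + 2 * pi) + p (\<theta> + 2 * pi + pi) - L / pi = p \<theta> + p (\<theta> + pi) - L / pi" for \<theta>
      unfolding per pp ..
    show "?I (\<lambda>\<theta>. p \<theta> + p (\<theta> + pi) - L / pi) = 0"
      using has_integral_diff[OF has_integral_add[OF hp hp\<pi>] hc[of "L / pi"]] by (simp add: integral_unique)
  qed (auto intro!: derivative_eq_intros p s p\<pi> s\<pi> cont simp: per pp field_simps)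
  have e1: "\<bar>1/2 * ((A - B) / 4)\<bar> = (B - A) / 8"
    using W_sign by simp
  have e2: "\<bar>1/2 * ?I C\<bar> = L\<^sup>2 / pi - A - B"
    using C_sign C by simp
  show ?thesis
    unfolding W_def[symmetric] C_def[symmetric] A_def[symmetric] W e1 e2
    by (simp add: field_simps)
qed

section \<open>Area of the convex body with a given support function\<close>

lemma lborel_complex_eq_distr_prod:
  "lborel = distr (lborel \<Otimes>\<^sub>M lborel) borel (\<lambda>(x, y). Complex x y)"
proof (rule lborel_eqI)
  have cont: "continuous_on UNIV (\<lambda>(x, y). Complex x y)"
    unfolding case_prod_beta Complex_eq by (intro continuous_intros)
  then have [measurable]: "(\<lambda>(x, y). Complex x y) \<in> borel_measurable (lborel \<Otimes>\<^sub>M lborel)"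
    by (simp add: lborel_prod borel_measurable_continuous_onI)
  fix l u :: complex
  assume "\<And>b. b \<in> Basis \<Longrightarrow> l \<bullet> b \<le> u \<bullet> b"
  then have le: "Re l \<le> Re u" "Im l \<le> Im u"
    by (force simp: Basis_complex_def)+
  have "(\<lambda>(x, y). Complex x y) -` box l u = box (Re l) (Re u) \<times> box (Im l) (Im u)"
    by (auto simp: box_def Basis_complex_def)
  then have "emeasure (distr (lborel \<Otimes>\<^sub>M lborel) borel (\<lambda>(x, y). Complex x y)) (box l u)
      = emeasure (lborel \<Otimes>\<^sub>M lborel) (box (Re l) (Re u) \<times> box (Im l) (Im u))"
    by (simp add: emeasure_distr space_pair_measure)
  also have "\<dots> = emeasure lborel (box (Re l) (Re u)) * emeasure lborel (box (Im l) (Im u))"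
    by (rule lborel.emeasure_pair_measure_Times) auto
  also have "\<dots> = ennreal ((Re u - Re l) * (Im u - Im l))"
    using le by (simp add: ennreal_mult)
  also have "(Re u - Re l) * (Im u - Im l) = (\<Prod>b\<in>Basis. (u - l) \<bullet> b)"
    by (simp add: Basis_complex_def)
  finally show "emeasure (distr (lborel \<Otimes>\<^sub>M lborel) borel (\<lambda>(x, y). Complex x y)) (box l u)
      = (\<Prod>b\<in>Basis. (u - l) \<bullet> b)" by simp
qed simp

text \<open>
  Fubini for the vertical slices, which are intervals.
\<close>

lemma area_between_graphs:
  fixes K :: "complex set" and l u :: "real \<Rightarrow> real"
  assumes K: "K \<in> sets borel"
    and slice: "\<And>x. x \<in> {a..b} \<Longrightarrow> {y. Complex x y \<in> K} = {l x..u x}"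
    and le: "\<And>x. x \<in> {a..b} \<Longrightarrow> l x \<le> u x"
    and outside: "\<And>z. z \<in> K \<Longrightarrow> Re z \<in> {a..b}"
    and l: "continuous_on {a..b} l" and u: "continuous_on {a..b} u"
  shows "measure lborel K = integral {a..b} u - integral {a..b} l"
proof -
  let ?X = "(\<lambda>(x, y). Complex x y) -` K"
  have cont: "continuous_on UNIV (\<lambda>(x, y). Complex x y)"
    unfolding case_prod_beta Complex_eq by (intro continuous_intros)
  then have meas: "(\<lambda>(x, y). Complex x y) \<in> borel_measurable (lborel \<Otimes>\<^sub>M lborel)"
    by (simp add: lborel_prod borel_measurable_continuous_onI)
  have X: "?X \<in> sets (lborel \<Otimes>\<^sub>M lborel)"
    using measurable_sets[OF meas K] by (simp add: space_pair_measure)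
  have "emeasure lborel K = emeasure (lborel \<Otimes>\<^sub>M lborel) ?X"
    by (subst lborel_complex_eq_distr_prod)
       (simp add: emeasure_distr[OF meas K] space_pair_measure)
  also have "\<dots> = (\<integral>\<^sup>+x. emeasure lborel (Pair x -` ?X) \<partial>lborel)"
    by (rule lborel.emeasure_pair_measure_alt[OF X])
  also have "\<dots> = (\<integral>\<^sup>+x. ennreal (indicator {a..b} x * (u x - l x)) \<partial>lborel)"
  proof (rule nn_integral_cong)
    fix x
    have eq: "Pair x -` ?X = {y. Complex x y \<in> K}" by auto
    show "emeasure lborel (Pair x -` ?X) = ennreal (indicator {a..b} x * (u x - l x))"
    proof (cases "x \<in> {a..b}")
      case True
      then show ?thesis unfolding eq slice[OF True] using le[OF True] by simp
    next
      case False
      then have "{y. Complex x y \<in> K} = {}" using outside by force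
      then show ?thesis unfolding eq using False by simp
    qed
  qed
  also have "\<dots> = ennreal (integral {a..b} u - integral {a..b} l)"
    by (rule nn_integral_has_integral_lebesgue)
       (use le in \<open>auto intro!: has_integral_diff integrable_integral integrable_continuous_interval l u\<close>)
  finally have "emeasure lborel K = ennreal (integral {a..b} u - integral {a..b} l)" .
  moreover have "integral {a..b} l \<le> integral {a..b} u"
    using le by (intro integral_le integrable_continuous_interval l u)
  ultimately show ?thesis by (simp add: measure_def)
qed

text \<open>
  Where the abscissa is injective the arc is the graph of a continuous function \<open>h\<close>, and
  substitution rewrites \<open>\<integral> y dx\<close> along the arc as an integral of \<open>h\<close>. Of the two integrals of \<open>h\<close>
  below, the one with descending bounds is zero, so their difference is the oriented integral for
  both directions of traversal.
\<close>

lemma graph_of_monotone_arc: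
  fixes X X' Y :: "real \<Rightarrow> real"
  assumes "a \<le> b"
    and X: "\<And>t. t \<in> {a..b} \<Longrightarrow> (X has_real_derivative X' t) (at t)"
    and inj: "inj_on X {a..b}" and Y: "continuous_on {a..b} Y"
    and img: "X ` {a..b} = {c..d}"
  obtains h where "continuous_on {c..d} h" "\<And>t. t \<in> {a..b} \<Longrightarrow> h (X t) = Y t"
    "((\<lambda>t. X' t * Y t) has_integral integral {X a..X b} h - integral {X b..X a} h) {a..b}"
proof -
  define h where "h = (\<lambda>x. Y (inv_into {a..b} X x))"
  have cX: "continuous_on {a..b} X"
    by (rule DERIV_continuous_on[where D = X']) (use X in \<open>auto intro: has_field_derivative_at_within\<close>)
  have "continuous_on (X ` {a..b}) (inv_into {a..b} X)"
    by (rule continuous_on_inv[OF cX]) (use inj in auto)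
  then have h: "continuous_on {c..d} h"
    unfolding h_def img[symmetric]
    by (rule continuous_on_compose2[OF Y]) (auto intro: inv_into_into)
  have hX: "h (X t) = Y t" if "t \<in> {a..b}" for t
    using that inj by (simp add: h_def)
  have "((\<lambda>t. X' t *\<^sub>R h (X t)) has_integral integral {X a..X b} h - integral {X b..X a} h) {a..b}"
    by (rule has_integral_substitution_general[where s = "{}" and c = c and d = d])
       (use \<open>a \<le> b\<close> img X cX h in \<open>auto intro: has_field_derivative_at_within\<close>)
  then have "((\<lambda>t. X' t * Y t) has_integral integral {X a..X b} h - integral {X b..X a} h) {a..b}"
    by (rule has_integral_eq[rotated]) (simp add: hX)
  then show thesis using that h hX by blast
qed

definition support_body :: "(real \<Rightarrow> real) \<Rightarrow> complex set" where
  "support_body p = {z. \<forall>\<alpha>. z \<bullet> cis \<alpha> \<le> p \<alpha>}"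

lemma inner_cis: "z \<bullet> cis \<alpha> = Re z * cos \<alpha> + Im z * sin \<alpha>"
  by (simp add: inner_complex_def)

lemma inner_cis_le_norm: "z \<bullet> cis \<alpha> \<le> norm z"
  using norm_cauchy_schwarz[of z "cis \<alpha>"] by simp

lemma convex_support_body: "convex (support_body p)"
proof -
  have "support_body p = (\<Inter>\<alpha>. {z. cis \<alpha> \<bullet> z \<le> p \<alpha>})"
    by (auto simp: support_body_def inner_commute)
  then show ?thesis by (simp add: convex_INT convex_halfspace_le)
qed

lemma closed_support_body: "closed (support_body p)"
proof -
  have "support_body p = (\<Inter>\<alpha>. {z. cis \<alpha> \<bullet> z \<le> p \<alpha>})"
    by (auto simp: support_body_def inner_commute)
  then show ?thesis by (simp add: closed_INT closed_halfspace_le)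
qed

lemma bounded_support_body:
  assumes "continuous_on UNIV p"
  shows "bounded (support_body p)"
proof -
  have "bounded (p ` {-pi..pi})"
    by (intro compact_imp_bounded compact_continuous_image continuous_on_subset[OF assms]) auto
  then obtain B where B: "\<forall>\<alpha>\<in>{-pi..pi}. \<bar>p \<alpha>\<bar> \<le> B"
    unfolding bounded_iff by auto
  have "norm z \<le> B" if "z \<in> support_body p" for z
  proof -
    have "norm z = z \<bullet> cis (Arg z)"
    proof (cases "z = 0")
      case False
      have "z = norm z *\<^sub>R cis (Arg z)"
        using cis_Arg[OF False] False by (simp add: sgn_div_norm)
      then have "z \<bullet> cis (Arg z) = norm z * (cis (Arg z) \<bullet> cis (Arg z))"
        by (metis inner_scaleR_left)
      then show ?thesis by (simp add: dot_square_norm)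
    qed simp
    also have "\<dots> \<le> p (Arg z)" using that by (simp add: support_body_def)
    also have "\<dots> \<le> B" using bspec[OF B, of "Arg z"] Arg_bounded[of z] by auto
    finally show ?thesis .
  qed
  then show ?thesis by (auto simp: bounded_iff)
qed

lemma support_curve_inner_normal: "support_curve p s \<theta> \<bullet> cis \<theta> = p \<theta>"
proof -
  have "support_curve p s \<theta> \<bullet> cis \<theta> = p \<theta> * (cos \<theta> * cos \<theta> + sin \<theta> * sin \<theta>)"
    unfolding distrib_left by (simp add: support_curve_def inner_cis algebra_simps)
  then show ?thesis by (simp only: sin_cos_squared_add3)
qed

text \<open>
  For fixed \<open>\<alpha>\<close> the height of the curve in direction \<open>cis \<alpha>\<close> has derivative
  \<open>\<rho> \<theta> sin (\<alpha> - \<theta>)\<close>: it rises on the half period before \<open>\<alpha>\<close>, falls on the half period after, and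
  so is largest at \<open>\<alpha>\<close>, where its value is \<open>p \<alpha>\<close>.
\<close>

lemma support_curve_inner_le:
  assumes p: "\<And>\<theta>. (p has_real_derivative s \<theta>) (at \<theta>)"
    and s: "\<And>\<theta>. (s has_real_derivative \<rho> \<theta> - p \<theta>) (at \<theta>)"
    and \<rho>: "\<And>\<theta>. 0 < \<rho> \<theta>"
    and per: "\<And>\<theta>. p (\<theta> + 2 * pi) = p \<theta>"
  shows "support_curve p s \<beta> \<bullet> cis \<alpha> \<le> p \<alpha>"
proof -
  define h where "h = (\<lambda>\<theta>. support_curve p s \<theta> \<bullet> cis \<alpha>)"
  have h: "(h has_real_derivative \<rho> \<theta> * sin (\<alpha> - \<theta>)) (at \<theta>)" for \<theta>
    unfolding h_def inner_cis support_curve_def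
    by (auto intro!: derivative_eq_intros p s simp: sin_diff algebra_simps)
  have per_s: "s (\<theta> + 2 * pi) = s \<theta>" for \<theta>
    by (rule periodic_derivative[OF p per])
  have per_h: "h (\<theta> + 2 * pi) = h \<theta>" for \<theta>
    by (simp add: h_def support_curve_def per per_s complex_eq_iff inner_cis)
  have "h \<beta> \<in> h ` {\<alpha> - pi..\<alpha> - pi + 2 * pi}"
    by (subst range_periodic[of h, OF per_h]) auto
  then obtain \<theta> where \<theta>: "\<theta> \<in> {\<alpha> - pi..\<alpha> - pi + 2 * pi}" "h \<beta> = h \<theta>"
    by blast
  have "h \<theta> \<le> h \<alpha>"
  proof (cases "\<theta> \<le> \<alpha>")
    case True
    show ?thesis
    proof (rule DERIV_nonneg_imp_nondecreasing[OF True])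
      fix x assume "\<theta> \<le> x" "x \<le> \<alpha>"
      then have "0 \<le> sin (\<alpha> - x)" using \<theta>(1) by (intro sin_ge_zero) auto
      then show "\<exists>y. (h has_real_derivative y) (at x) \<and> 0 \<le> y"
        using h \<rho>[of x] by (intro exI[of _ "\<rho> x * sin (\<alpha> - x)"]) simp
    qed
  next
    case False
    then have "\<alpha> \<le> \<theta>" by simp
    then show ?thesis
    proof (rule DERIV_nonpos_imp_nonincreasing)
      fix x assume "\<alpha> \<le> x" "x \<le> \<theta>"
      then have "0 \<le> sin (x - \<alpha>)" using \<theta>(1) by (intro sin_ge_zero) auto
      moreover have "sin (\<alpha> - x) = - sin (x - \<alpha>)" by (simp add: sin_diff)
      ultimately have "\<rho> x * sin (\<alpha> - x) \<le> 0"
        using \<rho>[of x] by (simp add: mult_nonneg_nonneg)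
      then show "\<exists>y. (h has_real_derivative y) (at x) \<and> y \<le> 0"
        using h by blast
    qed
  qed
  then show ?thesis
    using \<theta>(2) by (simp add: h_def support_curve_inner_normal)
qed

text \<open>
  The gap \<open>p \<theta> - z \<bullet> cis \<theta>\<close> is nonnegative and has a minimum at \<open>\<alpha>\<close>. The vanishing of its derivative
  determines the component of \<open>z\<close> along the supporting line.
\<close>

lemma support_body_contact_point:
  assumes p: "(p has_real_derivative s) (at \<alpha>)"
    and z: "z \<in> support_body p" and contact: "z \<bullet> cis \<alpha> = p \<alpha>"
  shows "z = cis \<alpha> * Complex (p \<alpha>) s"
proof -
  let ?f = "\<lambda>\<theta>. p \<theta> - (Re z * cos \<theta> + Im z * sin \<theta>)"
  have "(?f has_real_derivative s - (Im z * cos \<alpha> - Re z * sin \<alpha>)) (at \<alpha>)"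
    by (auto intro!: derivative_eq_intros p)
  moreover have "?f \<alpha> \<le> ?f \<theta>" for \<theta>
    using z contact by (simp add: support_body_def inner_cis)
  ultimately have "s - (Im z * cos \<alpha> - Re z * sin \<alpha>) = 0"
    by (intro DERIV_local_min[where f = ?f and d = 1]) auto
  then have "cnj (cis \<alpha>) * z = Complex (p \<alpha>) s"
    using contact by (simp add: complex_eq_iff inner_cis algebra_simps)
  moreover have "cis \<alpha> * (cnj (cis \<alpha>) * z) = z"
    by (simp add: cis_cnj cis_mult flip: mult.assoc)
  ultimately show ?thesis by simp
qed

text \<open>
  If no supporting line passes through \<open>z\<close>, then by compactness of the circle of directions the gap
  \<open>p \<alpha> - z \<bullet> cis \<alpha>\<close> is bounded below by some \<open>e > 0\<close>, and the ball of radius \<open>e\<close> about \<open>z\<close> lies in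
  the body. So each frontier point is the contact point of a supporting line.
\<close>

lemma frontier_support_body:
  assumes p: "\<And>\<theta>. (p has_real_derivative s \<theta>) (at \<theta>)"
    and per: "\<And>\<theta>. p (\<theta> + 2 * pi) = p \<theta>"
    and supp: "\<And>\<theta> \<alpha>. support_curve p s \<theta> \<bullet> cis \<alpha> \<le> p \<alpha>"
  shows "frontier (support_body p) = range (support_curve p s)"
proof -
  let ?K = "support_body p"
  have cp: "continuous_on A p" for A
    by (rule continuous_onI_has_real_derivative[OF p])
  have "frontier ?K = ?K - interior ?K"
    by (simp add: frontier_def closure_closed closed_support_body)
  also have "\<dots> = range (support_curve p s)"
  proof (intro equalityI subsetI)
    fix z assume z: "z \<in> ?K - interior ?K"
    have "\<exists>\<alpha>. z \<bullet> cis \<alpha> = p \<alpha>"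
    proof (rule ccontr)
      assume no: "\<not> ?thesis"
      let ?f = "\<lambda>\<alpha>. p \<alpha> - (Re z * cos \<alpha> + Im z * sin \<alpha>)"
      have "continuous_on {0..2 * pi} ?f"
        by (intro continuous_intros cp)
      then obtain \<beta> where \<beta>: "\<forall>\<alpha>\<in>{0..2 * pi}. ?f \<beta> \<le> ?f \<alpha>"
        using continuous_attains_inf[of "{0..2 * pi}" ?f] by auto
      define e where "e = ?f \<beta>"
      have "e > 0"
        using no z by (auto simp: e_def support_body_def inner_cis less_le) (metis)
      have "?f \<alpha> \<ge> e" for \<alpha>
      proof -
        have "?f (\<theta> + 2 * pi) = ?f \<theta>" for \<theta>
          by (simp add: per)
        then have "?f \<alpha> \<in> ?f ` {0..0 + 2 * pi}"
          by (subst range_periodic[of ?f]) auto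
        then obtain \<alpha>' where "\<alpha>' \<in> {0..0 + 2 * pi}" "?f \<alpha> = ?f \<alpha>'"
          by blast
        then show ?thesis
          using \<beta> by (simp add: e_def)
      qed
      then have gap: "z \<bullet> cis \<alpha> + e \<le> p \<alpha>" for \<alpha>
        by (simp add: inner_cis algebra_simps)
      have "ball z e \<subseteq> ?K"
      proof
        fix w assume "w \<in> ball z e"
        then have "norm (w - z) \<le> e" by (simp add: dist_norm norm_minus_commute)
        then have "w \<bullet> cis \<alpha> \<le> z \<bullet> cis \<alpha> + e" for \<alpha>
          using inner_cis_le_norm[of "w - z" \<alpha>] by (simp add: inner_diff_left)
        then show "w \<in> ?K"
          using gap by (auto simp: support_body_def intro: order_trans)
      qed
      then have "z \<in> interior ?K"
        using \<open>e > 0\<close> by (auto simp: mem_interior)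
      with z show False by simp
    qed
    then obtain \<alpha> where "z \<bullet> cis \<alpha> = p \<alpha>" ..
    then have "z = support_curve p s \<alpha>"
      using support_body_contact_point[OF p] z by (simp add: support_curve_def)
    then show "z \<in> range (support_curve p s)" by simp
  next
    fix z assume "z \<in> range (support_curve p s)"
    then obtain \<theta> where z: "z = support_curve p s \<theta>" by auto
    have "z \<notin> interior ?K"
    proof
      assume "z \<in> interior ?K"
      then obtain e where e: "e > 0" "ball z e \<subseteq> ?K" by (auto simp: mem_interior)
      let ?w = "z + (e / 2) *\<^sub>R cis \<theta>"
      have "?w \<in> ?K" using e by (intro subsetD[OF e(2)]) (simp add: dist_norm)
      then have "?w \<bullet> cis \<theta> \<le> p \<theta>" by (simp add: support_body_def)
      moreover have "?w \<bullet> cis \<theta> = p \<theta> + e / 2"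
        using support_curve_inner_normal[of p s \<theta>] by (simp add: z inner_add_left dot_square_norm)
      ultimately show False using e by simp
    qed
    then show "z \<in> ?K - interior ?K"
      using supp z by (simp add: support_body_def)
  qed
  finally show ?thesis .
qed

text \<open>
  The abscissa of the boundary curve decreases on \<open>[0, pi]\<close> and increases on \<open>[pi, 2 pi]\<close>, because its
  derivative is \<open>- \<rho> sin\<close>; so the body lies between the graphs of an upper function \<open>u\<close> and a lower
  function \<open>l\<close>. This gives the area as \<open>- \<integral> y dx\<close> along the boundary, which equals
  \<open>1/2 \<integral> x dy - y dx\<close> since \<open>x y\<close> is periodic.
\<close>

lemma measure_support_body:
  assumes p: "\<And>\<theta>. (p has_real_derivative s \<theta>) (at \<theta>)"
    and s: "\<And>\<theta>. (s has_real_derivative \<rho> \<theta> - p \<theta>) (at \<theta>)"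
    and \<rho>: "continuous_on UNIV \<rho>" "\<And>\<theta>. \<rho> \<theta> > 0"
    and per: "\<And>\<theta>. p (\<theta> + 2 * pi) = p \<theta>"
  shows "measure lborel (support_body p) = 1/2 * integral {0..2 * pi} (\<lambda>\<theta>. p \<theta> * \<rho> \<theta>)"
proof -
  let ?K = "support_body p"
  have supp: "support_curve p s \<theta> \<bullet> cis \<alpha> \<le> p \<alpha>" for \<theta> \<alpha>
    by (rule support_curve_inner_le[OF p s \<rho>(2) per])
  define X where "X = (\<lambda>\<theta>. Re (support_curve p s \<theta>))"
  define Y where "Y = (\<lambda>\<theta>. Im (support_curve p s \<theta>))"
  define X' where "X' = (\<lambda>\<theta>. - sin \<theta> * \<rho> \<theta>)"
  have X: "(X has_real_derivative X' \<theta>) (at \<theta>)" for \<theta>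
    unfolding X_def X'_def support_curve_def
    by (auto intro!: derivative_eq_intros p s simp: algebra_simps)
  have Y: "(Y has_real_derivative cos \<theta> * \<rho> \<theta>) (at \<theta>)" for \<theta>
    unfolding Y_def support_curve_def
    by (auto intro!: derivative_eq_intros p s simp: algebra_simps)
  have cX: "continuous_on A X" and cY: "continuous_on A Y" for A
    by (rule continuous_onI_has_real_derivative X Y)+
  have \<Gamma>_K: "Complex (X \<theta>) (Y \<theta>) \<in> ?K" for \<theta>
    using supp by (simp add: X_def Y_def support_body_def)
  have per_s: "s (\<theta> + 2 * pi) = s \<theta>" for \<theta>
    by (rule periodic_derivative[OF p per])
  have ends: "X 0 = p 0" "X pi = - p pi" "X (2 * pi) = X 0" "Y (2 * pi) = Y 0"
    using per[of 0] per_s[of 0] by (simp_all add: X_def Y_def support_curve_def)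
  have "X pi \<le> X 0"
  proof -
    have "X pi \<le> p 0"
      using supp[of pi 0] unfolding inner_cis by (simp add: X_def)
    then show ?thesis by (simp add: ends)
  qed

  have inj: "inj_on X {a..b}" if "\<And>\<theta>. \<theta> \<in> {a<..<b} \<Longrightarrow> sin \<theta> \<noteq> 0" for a b
  proof (rule linorder_inj_onI')
    fix \<theta> \<phi> assume \<theta>: "\<theta> \<in> {a..b}" "\<phi> \<in> {a..b}" "\<theta> < \<phi>"
    show "X \<theta> \<noteq> X \<phi>"
    proof
      assume "X \<theta> = X \<phi>"
      then obtain z where "\<theta> < z" "z < \<phi>" "X' z = 0"
        using Rolle_deriv[of \<theta> \<phi> X "\<lambda>\<theta> h. X' \<theta> * h"] \<theta>(3) cX X
        by (auto simp: has_field_derivative_def fun_eq_iff)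
      with that[of z] \<theta> \<rho>(2)[of z] show False by (auto simp: X'_def)
    qed
  qed
  have inj_upper: "inj_on X {0..pi}"
    using sin_gt_zero by (intro inj) (metis greaterThanLessThan_iff less_irrefl)
  have inj_lower: "inj_on X {pi..2 * pi}"
    using sin_lt_zero by (intro inj) (metis greaterThanLessThan_iff less_irrefl)
  have img_upper: "X ` {0..pi} = {X pi..X 0}"
    using continuous_injective_image_segment_1[of 0 pi X] cX inj_upper \<open>X pi \<le> X 0\<close>
    by (simp add: closed_segment_eq_real_ivl split: if_splits)
  have img_lower: "X ` {pi..2 * pi} = {X pi..X 0}"
    using continuous_injective_image_segment_1[of pi "2 * pi" X] cX inj_lower \<open>X pi \<le> X 0\<close>
    by (simp add: closed_segment_eq_real_ivl ends split: if_splits)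

  obtain u where u: "continuous_on {X pi..X 0} u" "\<And>\<theta>. \<theta> \<in> {0..pi} \<Longrightarrow> u (X \<theta>) = Y \<theta>"
    and u_int: "((\<lambda>\<theta>. X' \<theta> * Y \<theta>) has_integral integral {X 0..X pi} u - integral {X pi..X 0} u) {0..pi}"
    using graph_of_monotone_arc[OF pi_ge_zero X inj_upper cY img_upper] by blast
  obtain l where l: "continuous_on {X pi..X 0} l" "\<And>\<theta>. \<theta> \<in> {pi..2 * pi} \<Longrightarrow> l (X \<theta>) = Y \<theta>"
    and l_int: "((\<lambda>\<theta>. X' \<theta> * Y \<theta>) has_integral integral {X pi..X (2 * pi)} l - integral {X (2 * pi)..X pi} l) {pi..2 * pi}"
    using graph_of_monotone_arc[OF _ X inj_lower cY img_lower] pi_ge_zero by auto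

  \<comment> \<open>The supporting line is vertical exactly at the leftmost and the rightmost point, where the
      inequality \<open>vertical\<close> below is void and uniqueness of the contact point replaces it.\<close>
  have contact: "Im z = Y \<theta>" if "z \<in> ?K" "Re z = X \<theta>" "sin \<theta> = 0" for z \<theta>
  proof -
    have "z \<bullet> cis \<theta> = p \<theta>"
      using support_curve_inner_normal[of p s \<theta>] that by (simp add: inner_cis X_def)
    then have "z = cis \<theta> * Complex (p \<theta>) (s \<theta>)"
      by (rule support_body_contact_point[OF p that(1)])
    from arg_cong[OF this, of Im] show ?thesis
      by (simp add: Y_def support_curve_def)
  qed
  have vertical: "(Im z - Y \<theta>) * sin \<theta> \<le> 0" if "z \<in> ?K" "Re z = X \<theta>" for z \<theta>
  proof -
    have "z \<bullet> cis \<theta> \<le> support_curve p s \<theta> \<bullet> cis \<theta>"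
      unfolding support_curve_inner_normal using that by (simp add: support_body_def)
    then show ?thesis using that by (simp add: inner_cis X_def Y_def algebra_simps)
  qed
  have below: "Im z \<le> u (Re z)" if z: "z \<in> ?K" "Re z \<in> {X pi..X 0}" for z
  proof -
    obtain \<theta> where \<theta>: "\<theta> \<in> {0..pi}" "Re z = X \<theta>"
      using z(2) unfolding img_upper[symmetric] by auto
    show ?thesis
    proof (cases "sin \<theta> = 0")
      case True
      then show ?thesis using contact[OF z(1) \<theta>(2)] u(2)[OF \<theta>(1)] \<theta>(2) by simp
    next
      case False
      then have "sin \<theta> > 0" using sin_ge_zero[of \<theta>] \<theta>(1) by auto
      then show ?thesis
        using vertical[OF z(1) \<theta>(2)] u(2)[OF \<theta>(1)] \<theta>(2) by (simp add: mult_le_0_iff)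
    qed
  qed
  have above: "l (Re z) \<le> Im z" if z: "z \<in> ?K" "Re z \<in> {X pi..X 0}" for z
  proof -
    obtain \<theta> where \<theta>: "\<theta> \<in> {pi..2 * pi}" "Re z = X \<theta>"
      using z(2) unfolding img_lower[symmetric] by auto
    show ?thesis
    proof (cases "sin \<theta> = 0")
      case True
      then show ?thesis using contact[OF z(1) \<theta>(2)] l(2)[OF \<theta>(1)] \<theta>(2) by simp
    next
      case False
      then have "sin \<theta> < 0" using sin_le_zero[of \<theta>] \<theta>(1) by (cases "\<theta> = 2 * pi") auto
      then show ?thesis
        using vertical[OF z(1) \<theta>(2)] l(2)[OF \<theta>(1)] \<theta>(2) by (simp add: mult_le_0_iff)
    qed
  qed
  have on_K: "Complex x (u x) \<in> ?K" "Complex x (l x) \<in> ?K" if "x \<in> {X pi..X 0}" for x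
  proof -
    show "Complex x (u x) \<in> ?K"
      using that \<Gamma>_K u(2) unfolding img_upper[symmetric] by auto
    show "Complex x (l x) \<in> ?K"
      using that \<Gamma>_K l(2) unfolding img_lower[symmetric] by auto
  qed

  have "measure lborel ?K = integral {X pi..X 0} u - integral {X pi..X 0} l"
  proof (rule area_between_graphs)
    show "?K \<in> sets borel" using closed_support_body by (rule borel_closed)
    show "l x \<le> u x" if "x \<in> {X pi..X 0}" for x
      using below[OF on_K(2)[OF that]] that by simp
    show "{y. Complex x y \<in> ?K} = {l x..u x}" if x: "x \<in> {X pi..X 0}" for x
    proof (intro equalityI subsetI)
      fix y assume "y \<in> {y. Complex x y \<in> ?K}"
      then show "y \<in> {l x..u x}" using above[of "Complex x y"] below[of "Complex x y"] x by simp
    next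
      fix y assume y: "y \<in> {l x..u x}"
      have "x * cos \<alpha> + y * sin \<alpha> \<le> p \<alpha>" for \<alpha>
      proof (cases "sin \<alpha> \<ge> 0")
        case True
        then have "y * sin \<alpha> \<le> u x * sin \<alpha>" using y by (simp add: mult_right_mono)
        then show ?thesis using on_K(1)[OF x] by (simp add: support_body_def inner_cis) (metis add_left_mono order_trans)
      next
        case False
        then have "y * sin \<alpha> \<le> l x * sin \<alpha>" using y by (simp add: mult_right_mono_neg)
        then show ?thesis using on_K(2)[OF x] by (simp add: support_body_def inner_cis) (metis add_left_mono order_trans)
      qed
      then show "y \<in> {y. Complex x y \<in> ?K}" by (simp add: support_body_def inner_cis)
    qed
    show "Re z \<in> {X pi..X 0}" if "z \<in> ?K" for z
    proof -
      have "z \<bullet> cis 0 \<le> p 0" "z \<bullet> cis pi \<le> p pi"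
        using that unfolding support_body_def by blast+
      then show ?thesis by (simp add: inner_cis ends)
    qed
  qed (use u l in auto)
  also have "\<dots> = 1/2 * integral {0..2 * pi} (\<lambda>\<theta>. p \<theta> * \<rho> \<theta>)"
  proof -
    have degenerate: "integral {X 0..X pi} f = 0" for f :: "real \<Rightarrow> real"
      using \<open>X pi \<le> X 0\<close> by (cases "X pi = X 0") auto
    have XY: "((\<lambda>\<theta>. X' \<theta> * Y \<theta>) has_integral - integral {X pi..X 0} u + integral {X pi..X 0} l) {0..2 * pi}"
      by (rule has_integral_combine[of 0 pi])
         (use u_int l_int degenerate in \<open>auto simp: ends\<close>)
    have "integral {0..0 + 2 * pi} (\<lambda>\<theta>. X' \<theta> * Y \<theta> + X \<theta> * (cos \<theta> * \<rho> \<theta>)) = 0"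
      by (rule integral_derivative_over_period[where f = "\<lambda>\<theta>. X \<theta> * Y \<theta>"])
         (use ends in \<open>auto intro!: derivative_eq_intros X Y\<close>)
    moreover have "(\<lambda>\<theta>. X' \<theta> * Y \<theta> + X \<theta> * (cos \<theta> * \<rho> \<theta>)) integrable_on {0..2 * pi}"
      unfolding X'_def
      by (intro integrable_continuous_interval continuous_intros cX cY continuous_on_subset[OF \<rho>(1)]) auto
    ultimately have "((\<lambda>\<theta>. X' \<theta> * Y \<theta> + X \<theta> * (cos \<theta> * \<rho> \<theta>)) has_integral 0) {0..2 * pi}"
      by (simp add: has_integral_iff)
    from has_integral_diff[OF this has_integral_mult_right[OF XY, of 2]]
    have "integral {0..2 * pi} (\<lambda>\<theta>. X' \<theta> * Y \<theta> + X \<theta> * (cos \<theta> * \<rho> \<theta>) - 2 * (X' \<theta> * Y \<theta>))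
        = 2 * (integral {X pi..X 0} u - integral {X pi..X 0} l)"
      by (simp add: integral_unique)
    moreover have "X' \<theta> * Y \<theta> + X \<theta> * (cos \<theta> * \<rho> \<theta>) - 2 * (X' \<theta> * Y \<theta>) = p \<theta> * \<rho> \<theta>" for \<theta>
      unfolding support_curve_inner_normal[of p s \<theta>, symmetric]
      by (simp add: X'_def X_def Y_def inner_cis algebra_simps)
    ultimately show ?thesis by simp
  qed
  finally show ?thesis .
qed

section \<open>Total turning of a simple closed curve\<close>

text \<open>
  The factor \<open>k\<close> makes this applicable to logarithms of a function and of its negative. The
  difference of the logarithms takes values in a discrete set.
\<close>

lemma continuous_logs_differ_by_constant:
  fixes f g :: "real \<Rightarrow> complex"
  assumes f: "continuous_on {a..b} f" and g: "continuous_on {a..b} g"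
    and eq: "\<And>t. t \<in> {a..b} \<Longrightarrow> exp (f t) = k * exp (g t)"
    and s: "s \<in> {a..b}" and t: "t \<in> {a..b}"
  shows "f s - g s = f t - g t"
proof -
  have "(\<lambda>x. f x - g x) constant_on {a..b}"
  proof (rule continuous_discrete_range_constant)
    show "continuous_on {a..b} (\<lambda>x. f x - g x)"
      by (intro continuous_intros f g)
    have "2 * pi \<le> norm ((f y - g y) - (f x - g x))"
      if xy: "x \<in> {a..b}" "y \<in> {a..b}" "f y - g y \<noteq> f x - g x" for x y
    proof -
      have "exp (f z - g z) = k" if "z \<in> {a..b}" for z
        using eq[OF that] by (simp add: exp_diff)
      then have "exp (f y - g y) = exp (f x - g x)"
        using xy by simp
      then obtain n :: int where n: "f y - g y = (f x - g x) + (of_int (2 * n) * pi) * \<i>"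
        using exp_eq by blast
      with xy have "n \<noteq> 0" by auto
      then have "1 \<le> \<bar>real_of_int n\<bar>" by linarith
      moreover have "norm ((f y - g y) - (f x - g x)) = 2 * pi * \<bar>real_of_int n\<bar>"
        unfolding n by (simp add: norm_mult)
      ultimately show ?thesis by simp
    qed
    then show "\<exists>e>0. \<forall>y. y \<in> {a..b} \<and> f y - g y \<noteq> f x - g x \<longrightarrow> e \<le> norm (f y - g y - (f x - g x))"
      if "x \<in> {a..b}" for x
      using that by (intro exI[of _ "2 * pi"]) auto
  qed simp
  then show ?thesis
    using s t unfolding constant_on_def by auto
qed

text \<open>
  The difference quotient \<open>(c t - c s) / (t - s)\<close> of a curve with velocity \<open>v\<close>, extended
  continuously to the diagonal.
\<close>

definition mean_velocity :: "(real \<Rightarrow> complex) \<Rightarrow> real \<times> real \<Rightarrow> complex" where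
  "mean_velocity v = (\<lambda>(s, t). integral {0..1} (\<lambda>u. v (s + u * (t - s))))"

lemma continuous_mean_velocity:
  assumes "continuous_on UNIV v"
  shows "continuous_on UNIV (mean_velocity v)"
proof -
  have "continuous_on (UNIV \<times> cbox 0 1) (\<lambda>((s, t), u). v (s + u * (t - s)))"
    unfolding case_prod_beta
    by (intro continuous_on_compose2[OF assms] continuous_intros) auto
  then have "continuous_on (UNIV \<times> cbox 0 1) (\<lambda>(x, u). v (fst x + u * (snd x - fst x)))"
    by (simp add: case_prod_beta)
  from integral_continuous_on_param[OF this] show ?thesis
    by (simp add: mean_velocity_def case_prod_beta)
qed

lemma mean_velocity_times_gap:
  fixes c v :: "real \<Rightarrow> complex"
  assumes c: "\<And>t. (c has_vector_derivative v t) (at t)"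
  shows "of_real (t - s) * mean_velocity v (s, t) = c t - c s"
proof -
  have "((\<lambda>u. (t - s) *\<^sub>R v (s + u * (t - s))) has_integral
          c (s + 1 * (t - s)) - c (s + 0 * (t - s))) {0..1}"
  proof (rule fundamental_theorem_of_calculus)
    fix u :: real assume "u \<in> {0..1}"
    have "((c \<circ> (\<lambda>u. s + u * (t - s))) has_vector_derivative (t - s) *\<^sub>R v (s + u * (t - s))) (at u)"
      by (rule vector_diff_chain_at)
         (auto intro!: derivative_eq_intros c simp: has_real_derivative_iff_has_vector_derivative[symmetric])
    then show "((\<lambda>u. c (s + u * (t - s))) has_vector_derivative (t - s) *\<^sub>R v (s + u * (t - s)))
          (at u within {0..1})"
      by (simp add: o_def has_vector_derivative_at_within)
  qed simp
  then have "(t - s) *\<^sub>R integral {0..1} (\<lambda>u. v (s + u * (t - s))) = c t - c s"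
    unfolding integral_cmul[symmetric] by (subst integral_unique, assumption) simp
  then show ?thesis
    by (simp add: mean_velocity_def scaleR_conv_of_real)
qed

lemma mean_velocity_diagonal [simp]: "mean_velocity v (t, t) = v t"
  by (simp add: mean_velocity_def)

text \<open>
  A larger change of \<open>g\<close> would make it pass through two values at distance \<open>pi\<close>, namely \<open>pi/2\<close> and
  \<open>3 pi/2\<close> away from \<open>g a\<close>; there the sine takes opposite nonzero values. The sharp bound is \<open>pi\<close>,
  but any bound below \<open>3 pi\<close> suffices to single out \<open>pi\<close> among its odd multiples.
\<close>

lemma continuous_argument_in_upper_half_plane:
  fixes g :: "real \<Rightarrow> real"
  assumes g: "continuous_on {a..b} g" and "a \<le> b"
    and upper: "\<And>t. t \<in> {a..b} \<Longrightarrow> 0 \<le> sin (g t)"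
    and real: "sin (g a) = 0"
  shows "\<bar>g b - g a\<bar> \<le> pi * 3/2"
proof (rule ccontr)
  assume far: "\<not> ?thesis"
  have cos: "cos (g a) \<noteq> 0"
    using real sin_cos_squared_add[of "g a"] by auto
  obtain e :: real where e: "e = -1 \<or> e = 1" "3 * pi / 2 < e * (g b - g a)"
  proof (cases "g a \<le> g b")
    case True
    then show ?thesis using far that[of 1] by simp
  next
    case False
    then show ?thesis using far that[of "-1"] by simp
  qed
  have reach: "\<exists>t\<in>{a..b}. e * g t = y" if "e * g a \<le> y" "y \<le> e * g b" for y
  proof -
    have "continuous_on {a..b} (\<lambda>t. e * g t)"
      by (intro continuous_intros g)
    then show ?thesis
      using IVT'[of "\<lambda>t. e * g t" a y b] that \<open>a \<le> b\<close> by auto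
  qed
  obtain t1 t2 where t: "t1 \<in> {a..b}" "t2 \<in> {a..b}"
    "e * g t1 = e * g a + pi/2" "e * g t2 = e * g a + 3 * pi/2"
  proof -
    have "e * g a \<le> e * g a + pi/2" "e * g a + pi/2 \<le> e * g b"
         "e * g a \<le> e * g a + 3 * pi/2" "e * g a + 3 * pi/2 \<le> e * g b"
      using e(2) pi_gt_zero unfolding right_diff_distrib by linarith+
    then show thesis
      using reach that by meson
  qed
  have s: "sin (x + 3 * pi / 2) = - cos x" "sin (x - 3 * pi / 2) = cos x"
          "sin (x + pi / 2) = cos x" "sin (x - pi / 2) = - cos x" for x :: real
    using sin_3over2_pi cos_3over2_pi by (simp_all add: sin_add sin_diff)
  from e(1) have "sin (g t1) = - sin (g t2) \<and> sin (g t1) \<noteq> 0"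
  proof
    assume "e = -1"
    with t have "g t1 = g a - pi/2" "g t2 = g a - 3 * pi/2" by auto
    then show ?thesis using cos by (simp add: s)
  next
    assume "e = 1"
    with t have "g t1 = g a + pi/2" "g t2 = g a + 3 * pi/2" by auto
    then show ?thesis using cos by (simp add: s)
  qed
  then show False
    using upper[OF t(1)] upper[OF t(2)] by auto
qed

text \<open>
  Hopf's proof of the Umlaufsatz. On the strip \<open>0 \<le> t - s \<le> 1\<close> the direction of the chord from \<open>c s\<close> to
  \<open>c t\<close> extends to a continuous nonvanishing function \<open>F\<close>, equal to the velocity where \<open>s = t\<close> and to
  its negative where \<open>t = s + 1\<close>. As the strip is convex, \<open>F\<close> has a continuous logarithm, and the
  turning of the tangent, taken along the diagonal from \<open>(0, 0)\<close> to \<open>(1, 1)\<close>, may be computed via the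
  corner \<open>(0, 1)\<close>. On the first leg the chords start at the lowest point and stay in the upper half
  plane, so the argument changes by \<open>pi\<close> up to sign; on the second leg \<open>F\<close> is the negative of its
  values on the first one, and the argument changes by the same amount again.
\<close>

lemma hopf_total_turning_at_lowest_point:
  fixes c v \<Lambda> :: "real \<Rightarrow> complex"
  assumes c: "\<And>t. (c has_vector_derivative v t) (at t)"
    and v: "continuous_on UNIV v"
    and per: "\<And>t. c (t + 1) = c t"
    and simple: "\<And>s t. 0 < t - s \<Longrightarrow> t - s < 1 \<Longrightarrow> c s \<noteq> c t"
    and \<Lambda>: "continuous_on UNIV \<Lambda>" "\<And>t. exp (\<Lambda> t) = v t"
    and lowest: "\<And>t. Im (c 0) \<le> Im (c t)"
  shows "\<bar>Im (\<Lambda> 1) - Im (\<Lambda> 0)\<bar> = 2 * pi"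
proof -
  let ?D = "mean_velocity v"
  \<comment> \<open>Both \<open>?D (s, t)\<close> and \<open>- ?D (t, s + 1)\<close> point along the chord; they equal \<open>(1 - (t - s)) F\<close> and
      \<open>(t - s) F\<close>, so their sum needs no division and vanishes on neither edge of the strip.\<close>
  define F where "F = (\<lambda>(s, t). ?D (s, t) - ?D (t, s + 1))"
  define T where "T = {z :: real \<times> real. 0 \<le> snd z - fst z \<and> snd z - fst z \<le> 1}"
  have per_v: "v (t + 1) = v t" for t
    by (rule periodic_vector_derivative[OF c per])
  have F_chord: "of_real ((t - s) * (1 - (t - s))) * F (s, t) = c t - c s" for s t
  proof -
    have "of_real ((t - s) * (1 - (t - s))) * F (s, t)
        = of_real (1 - (t - s)) * (of_real (t - s) * ?D (s, t))
          - of_real (t - s) * (of_real (s + 1 - t) * ?D (t, s + 1))"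
      by (simp add: F_def algebra_simps)
    also have "\<dots> = of_real (1 - (t - s)) * (c t - c s) - of_real (t - s) * (c (s + 1) - c t)"
      unfolding mean_velocity_times_gap[OF c] ..
    also have "\<dots> = c t - c s"
      unfolding per by (simp add: algebra_simps)
    finally show ?thesis .
  qed
  have D_period: "?D (t, t + 1) = 0" for t
    using mean_velocity_times_gap[OF c, of "t + 1" t] by (simp add: per)
  have F_diag: "F (t, t) = v t" for t
    by (simp add: F_def D_period)
  have F_corner: "F (t, t + 1) = - v t" for t
    using per_v by (simp add: F_def D_period)
  have D_shift: "?D (s + 1, t + 1) = ?D (s, t)" for s t
  proof -
    have "v (s + 1 + u * (t + 1 - (s + 1))) = v (s + u * (t - s))" for u
      using per_v[of "s + u * (t - s)"] by (simp add: algebra_simps)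
    then show ?thesis by (simp add: mean_velocity_def)
  qed
  have F_flip: "F (t, 1) = - F (0, t)" for t
    using D_shift[of 0 t] by (simp add: F_def)
  have v_nz: "v t \<noteq> 0" for t
    using \<Lambda>(2)[of t] by (metis exp_not_eq_zero)
  have F_nz: "F z \<noteq> 0" if zT: "z \<in> T" for z
  proof -
    obtain s t where z: "z = (s, t)" by fastforce
    consider "t = s" | "t = s + 1" | "0 < t - s" "t - s < 1"
      using zT by (fastforce simp: T_def z)
    then show ?thesis
    proof cases
      case 3
      then have "c t - c s \<noteq> 0" using simple by fastforce
      then show ?thesis using F_chord[of t s] z by auto
    qed (use v_nz F_diag F_corner z in auto)
  qed
  have F_cont: "continuous_on UNIV F"
    unfolding F_def case_prod_beta
    by (intro continuous_intros continuous_on_compose2[OF continuous_mean_velocity[OF v]]) auto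
  have "convex T"
  proof -
    have "T = {z. (-1, 1) \<bullet> z \<ge> 0} \<inter> {z. (-1, 1) \<bullet> z \<le> 1}"
      by (auto simp: T_def inner_prod_def)
    then show ?thesis
      by (simp add: convex_Int convex_halfspace_ge convex_halfspace_le)
  qed
  then obtain G where G: "continuous_on T G" "\<And>z. z \<in> T \<Longrightarrow> F z = exp (G z)"
    using continuous_logarithm_on_contractible[of T F] F_nz F_cont convex_imp_contractible
      continuous_on_subset by (metis subset_UNIV)
  have G_cont: "continuous_on {0..1} (\<lambda>t. G (f t, g t))"
    if "continuous_on {0..1} f" "continuous_on {0..1} g" "\<And>t. t \<in> {0..1} \<Longrightarrow> (f t, g t) \<in> T"
    for f g :: "real \<Rightarrow> real"
    using that by (intro continuous_on_compose2[OF G(1)] continuous_intros) auto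
  have c1: "continuous_on {0..1} (\<lambda>t. G (0, t))" and c2: "continuous_on {0..1} (\<lambda>t. G (t, 1))"
    and c3: "continuous_on {0..1} (\<lambda>t. G (t, t))"
    by (rule G_cont; auto simp: T_def)+

  have along_diag: "\<Lambda> 1 - G (1, 1) = \<Lambda> 0 - G (0, 0)"
    by (rule continuous_logs_differ_by_constant[OF continuous_on_subset[OF \<Lambda>(1)] c3, of 1])
       (use F_diag G(2) \<Lambda>(2) in \<open>auto simp: T_def\<close>)
  have flip: "G (1, 1) - G (0, 1) = G (0, 1) - G (0, 0)"
    by (rule continuous_logs_differ_by_constant[OF c2 c1, of "-1"])
       (use F_flip G(2) in \<open>auto simp: T_def simp flip: G(2)\<close>)

  have "Im (v 0) = 0"
  proof -
    have "((\<lambda>t. Im (c t)) has_real_derivative Im (v 0)) (at 0)"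
      using bounded_linear.has_vector_derivative[OF bounded_linear_Im c]
      by (simp add: has_real_derivative_iff_has_vector_derivative)
    then show ?thesis
      by (rule DERIV_local_min[of _ _ _ 1]) (use lowest in auto)
  qed
  have upper: "0 \<le> sin (Im (G (0, t)))" if "t \<in> {0..1}" for t
  proof -
    consider "t = 0" | "t = 1" | "0 < t" "t < 1" using \<open>t \<in> _\<close> by force
    then have "0 \<le> Im (F (0, t))"
    proof cases
      case 3
      have "t * (1 - t) * Im (F (0, t)) = Im (c t) - Im (c 0)"
        using arg_cong[OF F_chord[of t 0], of Im] by simp
      then have "0 \<le> (t * (1 - t)) * Im (F (0, t))" using lowest[of t] by simp
      moreover have "0 < t * (1 - t)" using 3 by simp
      ultimately show ?thesis by (simp add: zero_le_mult_iff)
    qed (use F_diag[of 0] F_corner[of 0] \<open>Im (v 0) = 0\<close> in auto)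
    moreover have "(0, t) \<in> T" using that by (auto simp: T_def)
    ultimately show ?thesis
      by (simp add: G(2) Im_exp zero_le_mult_iff)
  qed
  have T01: "(0, 0) \<in> T" "(0, 1) \<in> T" by (auto simp: T_def)
  have "exp (G (0, 1)) = - exp (G (0, 0))"
    using F_diag[of 0] F_corner[of 0] G(2) T01 by simp
  then have "exp (G (0, 1)) = exp (G (0, 0) + \<i> * pi)"
    by (simp add: exp_add)
  then obtain n :: int where n: "G (0, 1) = G (0, 0) + \<i> * pi + (of_int (2 * n) * pi) * \<i>"
    using exp_eq by blast
  have "Im (exp (G (0, 0))) = 0"
    using F_diag[of 0] \<open>Im (v 0) = 0\<close> G(2)[OF T01(1)] by simp
  then have "sin (Im (G (0, 0))) = 0" by (simp add: Im_exp)
  then have "\<bar>Im (G (0, 1)) - Im (G (0, 0))\<bar> \<le> pi * 3/2"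
    by (intro continuous_argument_in_upper_half_plane[where g = "\<lambda>t. Im (G (0, t))"])
       (use c1 upper in \<open>auto intro!: continuous_intros\<close>)
  moreover have eq: "Im (G (0, 1)) - Im (G (0, 0)) = of_int (2 * n + 1) * pi"
    by (simp add: n algebra_simps)
  ultimately have "\<bar>of_int (2 * n + 1)\<bar> * pi \<le> 3 / 2 * pi"
    by (simp add: abs_mult)
  then have "\<bar>of_int (2 * n + 1)\<bar> \<le> (3 / 2 :: real)"
    using mult_le_cancel_right_pos[OF pi_gt_zero] by blast
  then have "real_of_int \<bar>2 * n + 1\<bar> < real_of_int 2"
    unfolding of_int_abs of_int_numeral by linarith
  then have "\<bar>2 * n + 1\<bar> < 2"
    by (simp only: of_int_less_iff)
  then have "2 * n + 1 = 1 \<or> 2 * n + 1 = -1" by presburger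
  then have "\<bar>Im (G (0, 1)) - Im (G (0, 0))\<bar> = pi"
    unfolding eq by (elim disjE) (simp_all only:, simp_all)
  moreover have "Im (\<Lambda> 1) - Im (\<Lambda> 0) = 2 * (Im (G (0, 1)) - Im (G (0, 0)))"
    using arg_cong[OF along_diag, of Im] arg_cong[OF flip, of Im] by simp
  ultimately show ?thesis by (simp only: abs_mult)
qed

text \<open>
  By periodicity the curve has a lowest point; a shift of the parameter moves it to \<open>0\<close>.
\<close>

lemma hopf_total_turning:
  fixes c v \<Lambda> :: "real \<Rightarrow> complex"
  assumes c: "\<And>t. (c has_vector_derivative v t) (at t)"
    and v: "continuous_on UNIV v"
    and per: "\<And>t. c (t + 1) = c t"
    and simple: "\<And>s t. 0 < t - s \<Longrightarrow> t - s < 1 \<Longrightarrow> c s \<noteq> c t"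
    and \<Lambda>: "continuous_on UNIV \<Lambda>" "\<And>t. exp (\<Lambda> t) = v t"
  shows "\<exists>t. \<bar>Im (\<Lambda> (t + 1)) - Im (\<Lambda> t)\<bar> = 2 * pi"
proof -
  have per_int: "c (t + of_int n) = c t" for t n
    using periodic_int[of c 1 t n, OF per] by simp
  have "continuous_on {0..1} c"
    by (rule continuous_at_imp_continuous_on)
       (use c has_vector_derivative_continuous in blast)
  then have "continuous_on {0..1} (\<lambda>t. Im (c t))"
    by (rule continuous_on_Im)
  then obtain t0 where t0: "\<forall>t\<in>{0..1}. Im (c t0) \<le> Im (c t)"
    using continuous_attains_inf[of "{0..1::real}" "\<lambda>t. Im (c t)"] by auto
  have low: "Im (c t0) \<le> Im (c t)" for t
    using bspec[OF t0, of "frac t"] per_int[of t "- \<lfloor>t\<rfloor>"] frac_lt_1[of t] frac_ge_0[of t]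
    by (simp add: frac_def less_imp_le)
  have "\<bar>Im (\<Lambda> (t0 + 1)) - Im (\<Lambda> (t0 + 0))\<bar> = 2 * pi"
  proof (rule hopf_total_turning_at_lowest_point[where c = "\<lambda>t. c (t0 + t)"
        and v = "\<lambda>t. v (t0 + t)" and \<Lambda> = "\<lambda>t. \<Lambda> (t0 + t)"])
    fix t
    have "((c \<circ> (\<lambda>t. t0 + t)) has_vector_derivative 1 *\<^sub>R v (t0 + t)) (at t)"
      by (rule vector_diff_chain_at)
         (auto intro!: derivative_eq_intros c simp: has_real_derivative_iff_has_vector_derivative[symmetric])
    then show "((\<lambda>t. c (t0 + t)) has_vector_derivative v (t0 + t)) (at t)"
      by (simp add: o_def)
    show "c (t0 + (t + 1)) = c (t0 + t)" unfolding add.assoc[symmetric] by (rule per)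
    show "Im (c (t0 + 0)) \<le> Im (c (t0 + t))" using low by simp
    show "exp (\<Lambda> (t0 + t)) = v (t0 + t)" by (rule \<Lambda>(2))
  next
    fix s t :: real assume "0 < t - s" "t - s < 1"
    then show "c (t0 + s) \<noteq> c (t0 + t)" by (intro simple) auto
  next
    show "continuous_on UNIV (\<lambda>t. v (t0 + t))"
      by (rule continuous_on_compose2[OF v]) (intro continuous_intros subset_UNIV)+
    show "continuous_on UNIV (\<lambda>t. \<Lambda> (t0 + t))"
      by (rule continuous_on_compose2[OF \<Lambda>(1)]) (intro continuous_intros subset_UNIV)+
  qed
  then show ?thesis by (intro exI[of _ t0]) simp
qed

section \<open>Reparametrization of an oval by its normal angle\<close>

text \<open>
  A continuous argument \<open>\<phi>\<close> of the velocity is the imaginary part of an antiderivative of \<open>a / v\<close>;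
  its derivative has the sign of the curvature. The total turning is known up to sign, and
  monotonicity of \<open>\<phi>\<close> settles the sign.
\<close>

lemma tangent_angle:
  fixes c v a :: "real \<Rightarrow> complex"
  assumes c: "\<And>t. (c has_vector_derivative v t) (at t)"
    and v: "\<And>t. (v has_vector_derivative a t) (at t)"
    and a: "continuous_on UNIV a"
    and nz: "\<And>t. v t \<noteq> 0"
    and curved: "\<And>t. 0 < Im (cnj (v t) * a t)"
    and per: "\<And>t. c (t + 1) = c t"
    and simple: "\<And>s t. 0 < t - s \<Longrightarrow> t - s < 1 \<Longrightarrow> c s \<noteq> c t"
  obtains \<phi> \<phi>' where
    "\<And>t. (\<phi> has_real_derivative \<phi>' t) (at t)" "\<And>t. 0 < \<phi>' t" "continuous_on UNIV \<phi>'"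
    "\<And>t. \<phi> (t + 1) = \<phi> t + 2 * pi" "\<And>t. v t = of_real (norm (v t)) * cis (\<phi> t)"
proof -
  have cv: "continuous_on UNIV v"
    using v by (intro continuous_at_imp_continuous_on ballI) (rule has_vector_derivative_continuous)
  have "continuous_on UNIV (\<lambda>t. a t / v t)"
    by (intro continuous_intros a cv) (use nz in auto)
  then obtain \<Lambda>0 where \<Lambda>0: "\<And>t. (\<Lambda>0 has_vector_derivative a t / v t) (at t)"
    by (rule antiderivative_on_line) blast
  have "((\<lambda>t. v t * exp (- \<Lambda>0 t)) has_vector_derivative 0) (at t)" for t
  proof -
    have "((\<lambda>t. exp (- \<Lambda>0 t)) has_vector_derivative - (a t / v t) * exp (- \<Lambda>0 t)) (at t)"
      using field_vector_diff_chain_at[OF has_vector_derivative_minus[OF \<Lambda>0] DERIV_exp]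
      by (simp add: o_def)
    from has_vector_derivative_mult[OF v this] show ?thesis
      using nz[of t] by simp
  qed
  then obtain k where k: "\<And>t. v t * exp (- \<Lambda>0 t) = k"
    using has_vector_derivative_zero_constant[of UNIV "\<lambda>t. v t * exp (- \<Lambda>0 t)"] by auto
  have "k \<noteq> 0" using k[of 0] nz[of 0] by auto
  define \<Lambda> where "\<Lambda> = (\<lambda>t. \<Lambda>0 t + Ln k)"
  have \<Lambda>: "(\<Lambda> has_vector_derivative a t / v t) (at t)" for t
    unfolding \<Lambda>_def using has_vector_derivative_add[OF \<Lambda>0 has_vector_derivative_const] by simp
  have exp_\<Lambda>: "exp (\<Lambda> t) = v t" for t
    using \<open>k \<noteq> 0\<close> by (simp add: \<Lambda>_def exp_add k[of t, symmetric] exp_minus nz)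
  define \<phi> where "\<phi> = (\<lambda>t. Im (\<Lambda> t))"
  define \<phi>' where "\<phi>' = (\<lambda>t. Im (a t / v t))"
  have \<phi>: "(\<phi> has_real_derivative \<phi>' t) (at t)" for t
    unfolding \<phi>_def \<phi>'_def has_real_derivative_iff_has_vector_derivative
    by (rule bounded_linear.has_vector_derivative[OF bounded_linear_Im \<Lambda>])
  have pos: "0 < \<phi>' t" for t
  proof -
    have "\<phi>' t = Im (cnj (v t) * a t) / (norm (v t))\<^sup>2"
      unfolding \<phi>'_def by (simp add: complex_div_cnj[of "a t"] mult.commute)
    then show ?thesis using curved[of t] nz[of t] by simp
  qed
  have cont: "continuous_on UNIV \<phi>'"
    unfolding \<phi>'_def by (intro continuous_intros a cv) (use nz in auto)
  have polar: "v t = of_real (norm (v t)) * cis (\<phi> t)" for t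
  proof -
    have "norm (v t) = exp (Re (\<Lambda> t))"
      by (simp flip: exp_\<Lambda>)
    then show ?thesis
      using exp_eq_polar[of "\<Lambda> t"] by (simp add: exp_\<Lambda> \<phi>_def)
  qed
  have pv: "v (t + 1) = v t" for t by (rule periodic_vector_derivative[OF c per])
  have pa: "a (t + 1) = a t" for t by (rule periodic_vector_derivative[OF v pv])
  have p\<phi>': "\<phi>' (t + 1) = \<phi>' t" for t by (simp add: \<phi>'_def pv pa)
  have "continuous_on UNIV \<Lambda>"
    using \<Lambda> by (intro continuous_at_imp_continuous_on ballI) (rule has_vector_derivative_continuous)
  then obtain t0 where t0: "\<bar>\<phi> (t0 + 1) - \<phi> t0\<bar> = 2 * pi"
    using hopf_total_turning[OF c cv per simple _ exp_\<Lambda>] unfolding \<phi>_def by blast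
  have "\<phi> t0 < \<phi> (t0 + 1)"
    by (rule DERIV_pos_imp_increasing) (use \<phi> pos in auto)
  with t0 have "\<phi> (t0 + 1) - \<phi> t0 = 2 * pi" by simp
  then have "\<phi> (t + 1) = \<phi> t + 2 * pi" for t
    using constant_increment_of_periodic_derivative[of \<phi> \<phi>' 1 t t0, OF \<phi> p\<phi>'] by simp
  from that[OF \<phi> pos cont this polar] show thesis .
qed

lemma inverse_of_increasing_angle:
  fixes \<phi> \<phi>' :: "real \<Rightarrow> real"
  assumes \<phi>: "\<And>t. (\<phi> has_real_derivative \<phi>' t) (at t)" and pos: "\<And>t. 0 < \<phi>' t"
    and turn: "\<And>t. \<phi> (t + 1) = \<phi> t + 2 * pi"
  obtains \<tau> where "\<And>x. \<phi> (\<tau> x) = x" "\<And>t. \<tau> (\<phi> t) = t"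
    "\<And>x. (\<tau> has_real_derivative 1 / \<phi>' (\<tau> x)) (at x)" "\<And>x. \<tau> (x + 2 * pi) = \<tau> x + 1"
proof -
  have mono: "\<phi> s < \<phi> t" if "s < t" for s t
    by (rule DERIV_pos_imp_increasing[OF that]) (use \<phi> pos in auto)
  then have inj: "inj \<phi>"
    by (metis injI linorder_neqE less_irrefl)
  have turns: "\<phi> (of_int n) = \<phi> 0 + of_int n * (2 * pi)" for n
  proof (induction n rule: int_induct[where k = 0])
    case (step1 i)
    then show ?case using turn[of "of_int i"] by (simp add: algebra_simps)
  next
    case (step2 i)
    then show ?case using turn[of "of_int i - 1"] by (simp add: algebra_simps)
  qed simp
  have surj: "\<exists>t. \<phi> t = x" for x
  proof -
    obtain n :: int where "of_int n \<le> (x - \<phi> 0) / (2 * pi)" "(x - \<phi> 0) / (2 * pi) \<le> of_int (n + 1)"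
      using that[of "\<lfloor>(x - \<phi> 0) / (2 * pi)\<rfloor>"] by linarith
    then have "\<phi> (of_int n) \<le> x" "x \<le> \<phi> (of_int (n + 1))"
      unfolding turns by (simp_all add: field_simps)
    moreover have "continuous_on {of_int n..of_int (n + 1)} \<phi>"
      by (rule continuous_onI_has_real_derivative[OF \<phi>])
    ultimately show ?thesis
      using IVT'[of \<phi> "of_int n" x "of_int (n + 1)"] by fastforce
  qed
  define \<tau> where "\<tau> = inv \<phi>"
  have \<tau>\<phi>: "\<tau> (\<phi> t) = t" for t using inj by (simp add: \<tau>_def)
  have \<phi>\<tau>: "\<phi> (\<tau> x) = x" for x using surj by (metis \<tau>\<phi>)
  have cont: "isCont \<tau> x" for x
    using isCont_inverse_function[of 1 "\<tau> x" \<tau> \<phi>] \<tau>\<phi> DERIV_isCont[OF \<phi>] by (simp add: \<phi>\<tau>)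
  have deriv: "(\<tau> has_real_derivative 1 / \<phi>' (\<tau> x)) (at x)" for x
    using DERIV_inverse_function[of \<phi> "\<phi>' (\<tau> x)" \<tau> x "x - 1" "x + 1"] \<phi> pos[of "\<tau> x"] \<phi>\<tau> cont
    by (simp add: inverse_eq_divide)
  have "\<tau> (x + 2 * pi) = \<tau> x + 1" for x
    using \<tau>\<phi>[of "\<tau> x + 1"] by (simp add: turn \<phi>\<tau>)
  from that[OF \<phi>\<tau> \<tau>\<phi> deriv this] show thesis .
qed

text \<open>
  A positively oriented oval together with the change of parameter \<open>\<tau>\<close> for which the outward normal
  at \<open>c (\<tau> \<theta>)\<close> is \<open>cis \<theta>\<close>. The function \<open>\<rho>\<close> is the radius of curvature, that is, the speed of
  \<open>c \<circ> \<tau>\<close>, and \<open>p\<close> and \<open>s\<close> are the normal and the tangential coordinate of the curve.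
\<close>

locale support_parametrized_oval =
  fixes c :: "real \<Rightarrow> complex" and \<tau> \<rho> p s :: "real \<Rightarrow> real"
  assumes period: "\<And>t. c (t + 1) = c t"
    and simple: "\<And>s t. 0 < t - s \<Longrightarrow> t - s < 1 \<Longrightarrow> c s \<noteq> c t"
    and regular: "\<And>t. velocity c t \<noteq> 0"
    and velocity: "\<And>t. (c has_vector_derivative velocity c t) (at t)"
    and cont_velocity: "continuous_on UNIV (velocity c)"
    and \<tau>_mono: "strict_mono \<tau>" and \<tau>_surj: "surj \<tau>" and \<tau>_turn: "\<And>\<theta>. \<tau> (\<theta> + 2 * pi) = \<tau> \<theta> + 1"
    and \<rho>: "continuous_on UNIV \<rho>" "\<And>\<theta>. 0 < \<rho> \<theta>"
    and \<tau>: "\<And>\<theta>. (\<tau> has_real_derivative \<rho> \<theta> / norm (velocity c (\<tau> \<theta>))) (at \<theta>)"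
    and tangent: "\<And>\<theta>. velocity c (\<tau> \<theta>) = of_real (norm (velocity c (\<tau> \<theta>))) * (\<i> * cis \<theta>)"
    and p_def: "p = (\<lambda>\<theta>. c (\<tau> \<theta>) \<bullet> cis \<theta>)" and s_def: "s = (\<lambda>\<theta>. c (\<tau> \<theta>) \<bullet> (\<i> * cis \<theta>))"
begin

lemma support_curve_eq: "support_curve p s \<theta> = c (\<tau> \<theta>)"
proof -
  have "Complex (p \<theta>) (s \<theta>) = cnj (cis \<theta>) * c (\<tau> \<theta>)"
    by (simp add: p_def s_def complex_eq_iff inner_complex_def algebra_simps)
  moreover have "cis \<theta> * (cnj (cis \<theta>) * c (\<tau> \<theta>)) = c (\<tau> \<theta>)"
    by (simp add: cis_cnj cis_mult flip: mult.assoc)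
  ultimately show ?thesis by (simp add: support_curve_def)
qed

lemma curve_derivative: "((\<lambda>\<theta>. c (\<tau> \<theta>)) has_vector_derivative of_real (\<rho> \<theta>) * (\<i> * cis \<theta>)) (at \<theta>)"
proof -
  have "((c \<circ> \<tau>) has_vector_derivative (\<rho> \<theta> / norm (velocity c (\<tau> \<theta>))) *\<^sub>R velocity c (\<tau> \<theta>)) (at \<theta>)"
    by (rule vector_diff_chain_at)
       (use \<tau> velocity in \<open>auto simp: has_real_derivative_iff_has_vector_derivative\<close>)
  also have "(\<rho> \<theta> / norm (velocity c (\<tau> \<theta>))) *\<^sub>R velocity c (\<tau> \<theta>) = of_real (\<rho> \<theta>) * (\<i> * cis \<theta>)"
    by (subst (2) tangent) (simp add: scaleR_conv_of_real regular)
  finally show ?thesis by (simp add: o_def)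
qed

lemma support_derivative: "(p has_real_derivative s \<theta>) (at \<theta>)"
proof -
  have "p = (\<lambda>\<theta>. Re (c (\<tau> \<theta>)) * cos \<theta> + Im (c (\<tau> \<theta>)) * sin \<theta>)"
    by (simp add: p_def inner_complex_def)
  then show ?thesis
    by (auto intro!: derivative_eq_intros curve_derivative simp: s_def inner_complex_def algebra_simps)
qed

lemma tangential_derivative: "(s has_real_derivative \<rho> \<theta> - p \<theta>) (at \<theta>)"
proof -
  have "s = (\<lambda>\<theta>. - Re (c (\<tau> \<theta>)) * sin \<theta> + Im (c (\<tau> \<theta>)) * cos \<theta>)"
    by (simp add: s_def inner_complex_def)
  moreover have "\<rho> \<theta> = \<rho> \<theta> * (cos \<theta> * cos \<theta> + sin \<theta> * sin \<theta>)"
    by (simp only: sin_cos_squared_add3)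
  ultimately show ?thesis
    unfolding distrib_left
    by (auto intro!: derivative_eq_intros curve_derivative simp: p_def inner_complex_def algebra_simps)
qed

lemma curve_turn: "c (\<tau> (\<theta> + 2 * pi)) = c (\<tau> \<theta>)"
  by (simp add: \<tau>_turn period)

lemma p_period: "p (\<theta> + 2 * pi) = p \<theta>"
  by (simp add: p_def curve_turn inner_complex_def)

lemma supporting: "support_curve p s \<theta> \<bullet> cis \<alpha> \<le> p \<alpha>"
  by (rule support_curve_inner_le[OF support_derivative tangential_derivative \<rho>(2) p_period])

lemma path_image_eq: "path_image c = range (support_curve p s)"
proof -
  have "path_image c = range c"
    using range_periodic[of c 1 0, OF period] by (simp add: path_image_def)
  also have "\<dots> = range (\<lambda>\<theta>. c (\<tau> \<theta>))"
    using \<tau>_surj by (metis image_comp comp_def image_cong)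
  finally show ?thesis by (simp add: support_curve_eq)
qed

lemma support_function_eq: "support_function c = p"
proof
  fix \<theta>
  show "support_function c \<theta> = p \<theta>"
    unfolding support_function_def path_image_eq
  proof (rule cSup_eq_maximum)
    show "p \<theta> \<in> (\<lambda>x. x \<bullet> cis \<theta>) ` range (support_curve p s)"
      using support_curve_inner_normal[of p s \<theta>] by (metis rangeI imageI)
  qed (use supporting in auto)
qed

lemma gamma_eq: "gamma c = support_curve p s"
proof -
  have "deriv p \<theta> = s \<theta>" for \<theta>
    using support_derivative by (rule DERIV_imp_deriv)
  then show ?thesis
    by (simp add: gamma_def support_function_eq Let_def support_curve_def fun_eq_iff complex_eq_iff algebra_simps)
qed

lemma velocity_period: "velocity c (t + 1) = velocity c t"
  by (rule periodic_vector_derivative[OF velocity period])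

lemma curve_length_eq: "curve_length c = integral {0..2 * pi} \<rho>"
proof -
  have cn: "continuous_on UNIV (\<lambda>t. norm (velocity c t))"
    by (intro continuous_intros cont_velocity)
  then obtain N where "\<And>t. (N has_vector_derivative norm (velocity c t)) (at t)"
    by (rule antiderivative_on_line) blast
  then have N: "(N has_real_derivative norm (velocity c t)) (at t)" for t
    by (simp add: has_real_derivative_iff_has_vector_derivative)
  have "((\<lambda>\<theta>. N (\<tau> \<theta>)) has_real_derivative \<rho> \<theta>) (at \<theta>)" for \<theta>
    using DERIV_chain2[OF N \<tau>, of \<theta>] regular by simp
  then have "(\<rho> has_integral N (\<tau> (2 * pi)) - N (\<tau> 0)) {0..2 * pi}"
    by (intro fundamental_theorem_of_calculus)
       (auto simp: has_real_derivative_iff_has_vector_derivative intro: has_vector_derivative_at_within)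
  moreover have "((\<lambda>t. norm (velocity c t)) has_integral N 1 - N 0) {0..1}"
    using N by (intro fundamental_theorem_of_calculus)
       (auto simp: has_real_derivative_iff_has_vector_derivative intro: has_vector_derivative_at_within)
  moreover have "N (\<tau> 0 + 1) - N (\<tau> 0) = N (0 + 1) - N 0"
    by (intro constant_increment_of_periodic_derivative[OF N]) (simp add: velocity_period)
  ultimately show ?thesis
    using \<tau>_turn[of 0] by (simp add: curve_length_def integral_unique)
qed

text \<open>
  The curve is the frontier of the convex body of its support function, and the inside of the frontier
  of a bounded convex set is its interior.
\<close>

lemma enclosed_area_eq: "enclosed_area c = 1/2 * integral {0..2 * pi} (\<lambda>\<theta>. p \<theta> * \<rho> \<theta>)"
proof -
  let ?K = "support_body p"
  have bounded: "bounded ?K"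
    by (rule bounded_support_body) (rule continuous_onI_has_real_derivative[OF support_derivative])
  have "inside (path_image c) = interior ?K"
    unfolding path_image_eq frontier_support_body[OF support_derivative p_period supporting, symmetric]
    by (rule inside_frontier_eq_interior[OF bounded convex_support_body])
  then have "enclosed_area c = measure lebesgue (interior ?K)"
    by (simp add: enclosed_area_def)
  also have "\<dots> = measure lebesgue ?K"
    by (rule measure_interior[OF bounded negligible_convex_frontier[OF convex_support_body]])
  also have "\<dots> = measure lborel ?K"
    using closed_support_body by (simp add: borel_closed)
  also have "\<dots> = 1/2 * integral {0..2 * pi} (\<lambda>\<theta>. p \<theta> * \<rho> \<theta>)"
    by (rule measure_support_body[OF support_derivative tangential_derivative \<rho> p_period])
  finally show ?thesis .
qed

lemma same_point_imp:
  assumes "c t = c t'"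
  obtains n :: int where "t = t' + of_int n"
proof -
  let ?n = "\<lfloor>t - t'\<rfloor>"
  have "c (t' + of_int ?n) = c t'"
    using periodic_int[of c 1 t' ?n, OF period] by simp
  moreover have "0 \<le> t - (t' + of_int ?n)" "t - (t' + of_int ?n) < 1"
    by linarith+
  ultimately have "t = t' + of_int ?n"
    using simple[of t "t' + of_int ?n"] assms by (cases "t - (t' + of_int ?n) = 0") (auto simp: less_le)
  then show thesis by (rule that)
qed

text \<open>
  The description defining \<open>unit_normal\<close> is unique because parameters of one point differ by
  integers, and the velocity has period 1.
\<close>

lemma unit_normal_eq: "unit_normal c (c (\<tau> \<theta>)) = - cis \<theta>"
proof -
  have sgn: "\<i> * sgn (velocity c (\<tau> \<theta>)) = - cis \<theta>"
    by (subst tangent) (simp add: sgn_mult regular sgn_of_real sgn_eq[of \<i>] flip: mult.assoc)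
  show ?thesis
    unfolding unit_normal_def
  proof (rule the_equality)
    show "\<exists>t. c t = c (\<tau> \<theta>) \<and> - cis \<theta> = \<i> * sgn (velocity c t)"
      using sgn by metis
  next
    fix n assume "\<exists>t. c t = c (\<tau> \<theta>) \<and> n = \<i> * sgn (velocity c t)"
    then obtain t where t: "c t = c (\<tau> \<theta>)" "n = \<i> * sgn (velocity c t)" by auto
    obtain m :: int where m: "t = \<tau> \<theta> + of_int m" using same_point_imp[OF t(1)] .
    have "velocity c t = velocity c (\<tau> \<theta>)"
      using periodic_int[of "velocity c" 1 "\<tau> \<theta>" m, OF velocity_period] m by simp
    then show "n = - cis \<theta>" using t(2) sgn by simp
  qed
qed

lemma affine_parallel_tangents:
  "affine_parallel (tangent_line c t) (tangent_line c t') \<longleftrightarrow> (\<exists>k. velocity c t' = k *\<^sub>R velocity c t)"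
proof
  assume "affine_parallel (tangent_line c t) (tangent_line c t')"
  then obtain a where a: "tangent_line c t' = (\<lambda>x. a + x) ` tangent_line c t"
    by (auto simp: affine_parallel_def)
  have "c t' + 0 *\<^sub>R velocity c t' \<in> tangent_line c t'" "c t' + 1 *\<^sub>R velocity c t' \<in> tangent_line c t'"
    unfolding tangent_line_def by blast+
  then have "c t' \<in> (\<lambda>x. a + x) ` tangent_line c t" "c t' + velocity c t' \<in> (\<lambda>x. a + x) ` tangent_line c t"
    unfolding a by simp_all
  then obtain x y where x: "c t' = a + (c t + x *\<^sub>R velocity c t)"
    and y: "c t' + velocity c t' = a + (c t + y *\<^sub>R velocity c t)"
    unfolding tangent_line_def by blast
  have "velocity c t' = (a + (c t + y *\<^sub>R velocity c t)) - (a + (c t + x *\<^sub>R velocity c t))"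
    using x y by (metis add_diff_cancel_left')
  then have "velocity c t' = (y - x) *\<^sub>R velocity c t"
    by (simp add: scaleR_left_diff_distrib)
  then show "\<exists>k. velocity c t' = k *\<^sub>R velocity c t" ..
next
  assume "\<exists>k. velocity c t' = k *\<^sub>R velocity c t"
  then obtain k where k: "velocity c t' = k *\<^sub>R velocity c t" ..
  then have "k \<noteq> 0" using regular[of t'] by auto
  have "tangent_line c t' = (\<lambda>x. (c t' - c t) + x) ` tangent_line c t"
  proof (intro equalityI subsetI)
    fix z assume "z \<in> tangent_line c t'"
    then obtain r where "z = c t' + r *\<^sub>R velocity c t'" by (auto simp: tangent_line_def)
    then have "z = (c t' - c t) + (c t + (r * k) *\<^sub>R velocity c t)" by (simp add: k)
    then show "z \<in> (\<lambda>x. (c t' - c t) + x) ` tangent_line c t"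
      unfolding tangent_line_def by blast
  next
    fix z assume "z \<in> (\<lambda>x. (c t' - c t) + x) ` tangent_line c t"
    then obtain x where "x \<in> tangent_line c t" "z = (c t' - c t) + x" by blast
    then obtain r where "z = (c t' - c t) + (c t + r *\<^sub>R velocity c t)"
      unfolding tangent_line_def by blast
    then have "z = c t' + (r / k) *\<^sub>R velocity c t'" using \<open>k \<noteq> 0\<close> by (simp add: k)
    then show "z \<in> tangent_line c t'" by (auto simp: tangent_line_def)
  qed
  then show "affine_parallel (tangent_line c t) (tangent_line c t')"
    unfolding affine_parallel_def by blast
qed

text \<open>
  Tangents are parallel iff the normal angles differ by a multiple of \<open>pi\<close>. An even multiple gives the
  same point, as the normal turns once in each period; an odd multiple gives the opposite one.
\<close>

lemma parallel_pair_iff: "parallel_pair c a b \<longleftrightarrow> (\<exists>\<theta>. a = c (\<tau> \<theta>) \<and> b = c (\<tau> (\<theta> + pi)))"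
proof
  assume "parallel_pair c a b"
  then obtain t t' k where ab: "a \<noteq> b" "a = c t" "b = c t'" and k: "velocity c t' = k *\<^sub>R velocity c t"
    by (auto simp: parallel_pair_def affine_parallel_tangents)
  obtain \<theta> \<theta>' where \<theta>: "t = \<tau> \<theta>" "t' = \<tau> \<theta>'"
    using \<tau>_surj by (metis surjD)
  let ?n = "norm (velocity c t)" and ?n' = "norm (velocity c t')"
  have "of_real ?n' * cis \<theta>' = of_real (k * ?n) * cis \<theta>"
    using k tangent[of \<theta>] tangent[of \<theta>'] unfolding \<theta>[symmetric]
    by (metis (no_types, lifting) complex_i_not_zero mult.assoc mult.left_commute mult_cancel_left of_real_mult scaleR_conv_of_real)
  then have "of_real ?n' * cis \<theta>' * cis (- \<theta>) = of_real (k * ?n) * cis \<theta> * cis (- \<theta>)"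
    by simp
  then have "of_real ?n' * cis (\<theta>' - \<theta>) = of_real (k * ?n)"
    by (simp add: cis_mult mult.assoc)
  from arg_cong[OF this, of Im] have "sin (\<theta>' - \<theta>) = 0"
    using regular[of t'] by simp
  then obtain n :: int where n: "\<theta>' - \<theta> = of_int n * pi"
    using sin_zero_iff_int2 by blast
  have "c (\<tau> (x + of_int m * (2 * pi))) = c (\<tau> x)" for x m
    by (rule periodic_int[of "\<lambda>x. c (\<tau> x)"]) (rule curve_turn)
  note turns = this
  show "\<exists>\<theta>. a = c (\<tau> \<theta>) \<and> b = c (\<tau> (\<theta> + pi))"
  proof (cases "even n")
    case True
    then obtain m where "n = 2 * m" by (elim evenE)
    then have "\<theta>' = \<theta> + of_int m * (2 * pi)" using n by simp
    then show ?thesis using turns ab \<theta> by auto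
  next
    case False
    then obtain m where "n = 2 * m + 1" by (elim oddE)
    then have "\<theta>' = (\<theta> + pi) + of_int m * (2 * pi)" using n by (simp add: algebra_simps)
    then show ?thesis using turns ab \<theta> by auto
  qed
next
  assume "\<exists>\<theta>. a = c (\<tau> \<theta>) \<and> b = c (\<tau> (\<theta> + pi))"
  then obtain \<theta> where \<theta>: "a = c (\<tau> \<theta>)" "b = c (\<tau> (\<theta> + pi))" by auto
  have "\<tau> \<theta> < \<tau> (\<theta> + pi)" "\<tau> (\<theta> + pi) < \<tau> (\<theta> + 2 * pi)"
    using \<tau>_mono by (simp_all add: strict_mono_less)
  then have "a \<noteq> b"
    using simple[of "\<tau> (\<theta> + pi)" "\<tau> \<theta>"] \<theta> by (simp add: \<tau>_turn)
  moreover have "velocity c (\<tau> (\<theta> + pi))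
      = (- norm (velocity c (\<tau> (\<theta> + pi))) / norm (velocity c (\<tau> \<theta>))) *\<^sub>R velocity c (\<tau> \<theta>)"
  proof -
    have "cis (\<theta> + pi) = - cis \<theta>" by (simp add: complex_eq_iff)
    then have "velocity c (\<tau> (\<theta> + pi)) = - of_real (norm (velocity c (\<tau> (\<theta> + pi)))) * (\<i> * cis \<theta>)"
      by (subst tangent) simp
    also have "\<i> * cis \<theta> = (1 / norm (velocity c (\<tau> \<theta>))) *\<^sub>R velocity c (\<tau> \<theta>)"
      by (subst (2) tangent) (simp add: scaleR_conv_of_real regular)
    finally show ?thesis
      unfolding scaleR_conv_of_real by (rule trans) simp
  qed
  ultimately show "parallel_pair c a b"
    unfolding parallel_pair_def affine_parallel_tangents using \<theta> by blast
qed

text \<open>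
  Since \<open>cis (\<theta> + pi) = - cis \<theta>\<close>, the opposite point is again a support curve in the frame of \<open>\<theta>\<close>, up to
  sign. That is why the derived curves have the support functions \<open>(p - p\<^sub>\<pi>) / 2\<close> and
  \<open>p + p\<^sub>\<pi> - w\<close>, where \<open>w\<close> is the average width.
\<close>

lemma opposite_point: "support_curve p s (\<theta> + pi) = - support_curve (\<lambda>\<theta>. p (\<theta> + pi)) (\<lambda>\<theta>. s (\<theta> + pi)) \<theta>"
  by (simp add: support_curve_def complex_eq_iff)

lemma wigner_caustic_curve_eq:
  "wigner_caustic_curve c
    = support_curve (\<lambda>\<theta>. (p \<theta> - p (\<theta> + pi)) / 2) (\<lambda>\<theta>. (s \<theta> - s (\<theta> + pi)) / 2)"
  unfolding wigner_caustic_curve_def gamma_eq opposite_point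
  by (simp add: fun_eq_iff support_curve_def complex_eq_iff field_simps)

lemma CWMS_curve_eq:
  "CWMS_curve c
    = support_curve (\<lambda>\<theta>. p \<theta> + p (\<theta> + pi) - average_width c) (\<lambda>\<theta>. s \<theta> + s (\<theta> + pi))"
  unfolding CWMS_curve_def gamma_eq opposite_point
  by (simp add: support_curve_eq unit_normal_eq fun_eq_iff)
     (simp flip: support_curve_eq add: support_curve_def complex_eq_iff algebra_simps)

lemma wigner_caustic_image: "wigner_caustic_curve c ` {0..pi} = wigner_caustic c"
proof -
  have "wigner_caustic_curve c (\<theta> + pi) = wigner_caustic_curve c \<theta>" for \<theta>
    using curve_turn[of \<theta>]
    by (simp add: wigner_caustic_curve_def gamma_eq support_curve_eq add.commute add.left_commute)
  then have "wigner_caustic_curve c ` {0..0 + pi} = range (wigner_caustic_curve c)"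
    by (rule range_periodic) simp
  also have "\<dots> = wigner_caustic c"
    unfolding wigner_caustic_def parallel_pair_iff wigner_caustic_curve_def gamma_eq support_curve_eq
      full_SetCompr_eq[symmetric] by blast
  finally show ?thesis by simp
qed

lemma CWMS_image: "CWMS_curve c ` {0..2 * pi} = CWMS c"
proof -
  have "c (\<tau> (\<theta> + 2 * pi + pi)) = c (\<tau> (\<theta> + pi))" for \<theta>
    using curve_turn[of "\<theta> + pi"] by (simp add: add.commute add.left_commute)
  then have "CWMS_curve c (\<theta> + 2 * pi) = CWMS_curve c \<theta>" for \<theta>
    by (simp add: CWMS_curve_def gamma_eq support_curve_eq curve_turn)
  then have "CWMS_curve c ` {0..0 + 2 * pi} = range (CWMS_curve c)"
    by (rule range_periodic) simp
  also have "\<dots> = CWMS c"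
    unfolding CWMS_def parallel_pair_iff CWMS_curve_def gamma_eq support_curve_eq
      full_SetCompr_eq[symmetric] by blast
  finally show ?thesis by simp
qed

lemma shifted_derivatives:
  "((\<lambda>\<theta>. p (\<theta> + pi)) has_real_derivative s (\<theta> + pi)) (at \<theta>)"
  "((\<lambda>\<theta>. s (\<theta> + pi)) has_real_derivative \<rho> (\<theta> + pi) - p (\<theta> + pi)) (at \<theta>)"
  using support_derivative[of "\<theta> + pi"] tangential_derivative[of "\<theta> + pi"] unfolding DERIV_shift .

lemma wigner_caustic_area_eq:
  "wigner_caustic_area c
    = 1/2 * integral {0..pi} (\<lambda>\<theta>. (p \<theta> - p (\<theta> + pi)) / 2 * ((\<rho> \<theta> - \<rho> (\<theta> + pi)) / 2))"
  unfolding wigner_caustic_area_def wigner_caustic_curve_eq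
  by (rule oriented_area_support_curve)
     (auto intro!: derivative_eq_intros support_derivative tangential_derivative shifted_derivatives simp: field_simps)

lemma CWMS_area_eq:
  "CWMS_area c = 1/2 * integral {0..2 * pi}
      (\<lambda>\<theta>. (p \<theta> + p (\<theta> + pi) - average_width c) * (\<rho> \<theta> + \<rho> (\<theta> + pi) - average_width c))"
  unfolding CWMS_area_def CWMS_curve_eq
  by (rule oriented_area_support_curve)
     (auto intro!: derivative_eq_intros support_derivative tangential_derivative shifted_derivatives)

lemma isoperimetric_equality:
  "(curve_length c)\<^sup>2 = 4 * pi * enclosed_area c
    + 8 * pi * \<bar>wigner_caustic_area c\<bar> + pi * \<bar>CWMS_area c\<bar>"
  unfolding enclosed_area_eq wigner_caustic_area_eq CWMS_area_eq average_width_def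
  by (rule support_isoperimetric_identity[OF support_derivative tangential_derivative \<rho>(1) p_period curve_length_eq])

end

text \<open>
  The tangent angle \<open>\<phi>\<close> increases by \<open>2 pi\<close> per period and is therefore invertible on the line; the
  outward normal lags behind the tangent by \<open>pi / 2\<close>.
\<close>

lemma positively_oriented_oval_support_parametrized:
  assumes "oval c" "positively_oriented c"
  obtains \<tau> \<rho> p s where "support_parametrized_oval c \<tau> \<rho> p s"
proof -
  let ?v = "velocity c" and ?a = "velocity (velocity c)"
  have smooth: "(velocity ^^ n) c differentiable (at t)" for n t
    using assms(1) by (simp add: oval_def closed_regular_simple_def smooth_curve_def)
  have c: "(c has_vector_derivative ?v t) (at t)" for t
    using smooth[of 0 t] by (simp add: velocity_def vector_derivative_works)
  have v: "(?v has_vector_derivative ?a t) (at t)" for t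
    using smooth[of 1 t] unfolding velocity_def[of "velocity c"] by (simp add: vector_derivative_works)
  have cv: "continuous_on UNIV ?v"
    using smooth[of 1] by (intro continuous_at_imp_continuous_on ballI differentiable_imp_continuous_within) auto
  have ca: "continuous_on UNIV ?a"
    using smooth[of 2] by (intro continuous_at_imp_continuous_on ballI differentiable_imp_continuous_within)
      (auto simp: numeral_2_eq_2)
  have period: "c (t + 1) = c t" for t
    using assms(1) by (simp add: oval_def closed_regular_simple_def)
  have nz: "?v t \<noteq> 0" for t
    using assms(1) by (simp add: oval_def closed_regular_simple_def)
  have curved: "0 < Im (cnj (?v t) * ?a t)" for t
    using assms(2) nz[of t] by (simp add: positively_oriented_def signed_curvature_def zero_less_divide_iff)
  have simple: "c t1 \<noteq> c t2" if t: "0 < t2 - t1" "t2 - t1 < 1" for t1 t2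
  proof
    assume eq: "c t1 = c t2"
    have "simple_path c"
      using assms(1) by (simp add: oval_def closed_regular_simple_def)
    then have inj: "x = y \<or> x = 0 \<and> y = 1 \<or> x = 1 \<and> y = 0"
      if "x \<in> {0..1}" "y \<in> {0..1}" "c x = c y" for x y
      using that unfolding simple_path_def loop_free_def by blast
    \<comment> \<open>Simplicity of the path concerns parameters in \<open>[0, 1]\<close>; fractional parts reduce to that case, and
        their equality would make \<open>t2 - t1\<close> an integer.\<close>
    have frac: "c (frac x) = c x" for x
      using periodic_int[of c 1 "frac x" "\<lfloor>x\<rfloor>", OF period] by (simp add: frac_def)
    have "frac t1 = frac t2 \<or> frac t1 = 1 \<or> frac t2 = 1"
      using inj[of "frac t1" "frac t2"] frac eq frac_lt_1[of t1] frac_lt_1[of t2] by (simp add: less_imp_le)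
    then have "t2 - t1 = of_int (\<lfloor>t2\<rfloor> - \<lfloor>t1\<rfloor>)"
      using frac_lt_1[of t1] frac_lt_1[of t2] by (auto simp: frac_def)
    then show False using t by (metis of_int_0_less_iff of_int_less_1_iff zless_imp_add1_zle add_0 not_le)
  qed
  obtain \<phi> \<phi>' where \<phi>: "\<And>t. (\<phi> has_real_derivative \<phi>' t) (at t)" "\<And>t. 0 < \<phi>' t"
      "continuous_on UNIV \<phi>'" "\<And>t. \<phi> (t + 1) = \<phi> t + 2 * pi"
    and polar: "\<And>t. ?v t = of_real (norm (?v t)) * cis (\<phi> t)"
    using tangent_angle[OF c v ca nz curved period simple] by blast
  obtain \<sigma> where \<sigma>: "\<And>x. \<phi> (\<sigma> x) = x" "\<And>t. \<sigma> (\<phi> t) = t"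
    "\<And>x. (\<sigma> has_real_derivative 1 / \<phi>' (\<sigma> x)) (at x)" "\<And>x. \<sigma> (x + 2 * pi) = \<sigma> x + 1"
    using inverse_of_increasing_angle[OF \<phi>(1,2,4)] by blast
  define \<tau> where "\<tau> = (\<lambda>\<theta>. \<sigma> (\<theta> + pi / 2))"
  have \<tau>: "(\<tau> has_real_derivative 1 / \<phi>' (\<tau> \<theta>)) (at \<theta>)" for \<theta>
    using \<sigma>(3)[of "\<theta> + pi / 2"] unfolding \<tau>_def DERIV_shift .
  have c\<tau>: "continuous_on UNIV \<tau>"
    by (rule continuous_onI_has_real_derivative[OF \<tau>])
  show thesis
  proof (rule that, unfold_locales)
    show "strict_mono \<tau>"
      by (rule strict_monoI, rule DERIV_pos_imp_increasing)
         (use \<tau> \<phi>(2) in \<open>auto intro!: exI zero_less_divide_1_iff[THEN iffD2]\<close>)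
    show "surj \<tau>"
      unfolding surj_def \<tau>_def using \<sigma>(2) by (metis diff_add_cancel)
    show "\<tau> (\<theta> + 2 * pi) = \<tau> \<theta> + 1" for \<theta>
      using \<sigma>(4)[of "\<theta> + pi / 2"] by (simp add: \<tau>_def ac_simps)
    show "continuous_on UNIV (\<lambda>\<theta>. norm (?v (\<tau> \<theta>)) / \<phi>' (\<tau> \<theta>))"
    proof (intro continuous_on_divide continuous_on_norm)
      show "continuous_on UNIV (\<lambda>\<theta>. ?v (\<tau> \<theta>))" "continuous_on UNIV (\<lambda>\<theta>. \<phi>' (\<tau> \<theta>))"
        by (rule continuous_on_compose2[OF cv c\<tau> subset_UNIV] continuous_on_compose2[OF \<phi>(3) c\<tau> subset_UNIV])+
      show "\<forall>\<theta>\<in>UNIV. \<phi>' (\<tau> \<theta>) \<noteq> 0" using \<phi>(2) by (metis less_irrefl)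
    qed
    show "0 < norm (?v (\<tau> \<theta>)) / \<phi>' (\<tau> \<theta>)" for \<theta>
      using nz \<phi>(2) by simp
    show "(\<tau> has_real_derivative norm (?v (\<tau> \<theta>)) / \<phi>' (\<tau> \<theta>) / norm (?v (\<tau> \<theta>))) (at \<theta>)" for \<theta>
      using \<tau>[of \<theta>] nz by simp
    show "?v (\<tau> \<theta>) = of_real (norm (?v (\<tau> \<theta>))) * (\<i> * cis \<theta>)" for \<theta>
    proof -
      have "cis (\<phi> (\<tau> \<theta>)) = \<i> * cis \<theta>"
        by (simp add: \<tau>_def \<sigma>(1) complex_eq_iff cos_add sin_add)
      then show ?thesis using polar[of "\<tau> \<theta>"] by simp
    qed
  qed (use period nz c cv simple in auto)
qed

theorem theorem5p1:
  fixes c :: "real \<Rightarrow> complex"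
  assumes "oval c" and "positively_oriented c"
  shows "wigner_caustic_curve c ` {0..pi} = wigner_caustic c
       \<and> CWMS_curve c ` {0..2 * pi} = CWMS c
       \<and> (curve_length c)\<^sup>2 =
           4 * pi * enclosed_area c
           + 8 * pi * \<bar>wigner_caustic_area c\<bar>
           + pi * \<bar>CWMS_area c\<bar>"
proof -
  obtain \<tau> \<rho> p s where "support_parametrized_oval c \<tau> \<rho> p s"
    using positively_oriented_oval_support_parametrized[OF assms] .
  then interpret support_parametrized_oval c \<tau> \<rho> p s .
  show ?thesis
    using wigner_caustic_image CWMS_image isoperimetric_equality by simp
qed

end
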